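(* Let $\mathbb T$ be either the set of non-negative integers or the set of non-negative real numbers. Let $(\Omega,\mathcal F,P)$ be a probability space and $T^t:\Omega\to\Omega$, $t\in\mathbb T$, a semigroup of measure-preserving maps such that $T^t$ is ergodic for each $t>0$. Let $X$ be a metric space with metric $\rho$ and Borel $\sigma$-algebra $\mathcal X$. For each $t\in\mathbb T$ let $C_t:X\times\Omega\to X$ be jointly measurable, and suppose the family $(C_t)_{t\in\mathbb T}$ is a cocycle, i.e. $C_0(x,\omega)=x$ and $C_{t+s}(\cdot,\omega)=C_s(\cdot,T^t\omega)\circ C_t(\cdot,\omega)$ for all $t,s\in\mathbb T$, $x\in X$, $\omega\in\Omega$. Let $\bar x_t(\omega)$, $t\in\mathbb T$, be an equilibrium path, i.e. random elements of $X$ such that with probability one $\bar x_t(\omega)=C_t(\bar x_0(\omega),\omega)$ and $\bar x_t(\omega)=\bar x_0(T^t\omega)$ for all $t\in\mathbb T$; write $\bar x(\omega):=\bar x_0(\omega)$. Let $X(\omega)\subseteq X$ ($\omega\in\Omega$) be a random set such that $\bar x(\omega)\in X(\omega)$ for each $\omega$, and $C_t(x,\omega)\in X(T^t\omega)$ for all $t\in\mathbb T$, $\omega\in\Omega$ and $x\in X(\omega)$. For $\delta>0$ put $\bar X(\omega,\delta):=\{x\in X(\omega):\rho(x,\bar x(\omega))\le\delta\}$. For $a\in X$ put $x_t^a(\omega):=C_t(a,\omega)$. Assume: (C1) There exists $M\in\mathbb T$, $M>0$, such that the mapping $f(x,\omega):=C_M(x,\omega)$ satisfies at least one of the following two conditions.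 (A) $(X,\rho)$ is a complete separable metric space, and there exist random variables $L(\omega)>0$ and $\delta(\omega)>0$ such that $E|\ln L|<+\infty$, $E|\ln\delta|<+\infty$, $E\ln L<0$, and $\rho(f(x,\omega),f(\bar x(\omega),\omega))\le L(\omega)\,\rho(x,\bar x(\omega))$ for all $x\in\bar X(\omega,\delta(\omega))$. (B) $X$ is a separable Banach space with norm $\|\cdot\|$ and $\rho(x,y)=\|x-y\|$; there exist random variables $L(\omega)>0$ and $\delta(\omega)>0$ such that $E|\ln L|<+\infty$, $E|\ln\delta|<+\infty$, and $\rho(f(x,\omega),f(\bar x(\omega),\omega))\le L(\omega)\,\rho(x,\bar x(\omega))$ for all $x\in\bar X(\omega,\delta(\omega))$; and for each $\omega$ the mapping $f(\cdot,\omega)$ has a Fréchet derivative $f'(\bar x(\omega),\omega)$ at $\bar x(\omega)$, with $E\ln\|f'(\bar x(\omega),\omega)\|<0$. (C2) For this $M$, there are random variables $H(\omega)>0$, $\kappa(\omega)>0$ and a constant $b>0$ such that $E|\ln H|<+\infty$, $E|\ln\kappa|<+\infty$ and, with probability one, $$\rho(C_t(x,\omega),C_t(\bar x(\omega),\omega))\le H(\omega)\,\rho(x,\bar x(\omega))^{b}$$ for all $x\in\bar X(\omega,\kappa(\omega))$ and all $t\in\mathbb T$ with $0\le t\le M$. Then there exist a random variable $\gamma(\omega)>0$ and a constant $d<0$ such that, almost surely (i.e. for all $\omega$ in a set of full measure not depending on $a$), $$\limsup_{\mathbb T\ni t\to\infty}\frac1t\ln\rho(x_t^a(\omega),\bar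 x_t(\omega))\le d\quad\text{for all }a\in\bar X(\omega,\gamma(\omega)).$$
   Context: $E$ denotes expectation with respect to $P$. A measure-preserving map $S:\Omega\to\Omega$ is an $\mathcal F$-measurable map with $P(S^{-1}(\Gamma))=P(\Gamma)$ for all $\Gamma\in\mathcal F$ (not necessarily invertible); it is ergodic if every $S$-invariant set has measure $0$ or $1$. Semigroup means $T^0=\mathrm{id}$ and $T^{t+s}=T^t\circ T^s$. A family $X(\omega)\subseteq X$, $\omega\in\Omega$, is a random set if its graph $\{(u,\omega)\in X\times\Omega:u\in X(\omega)\}$ belongs to $\mathcal X\otimes\mathcal F$. Random variables are real-valued. Convention: $\ln 0=-\infty$; the expectation $E\ln\|f'(\bar x(\omega),\omega)\|$ may equal $-\infty$. The Fréchet derivative at $\bar x(\omega)$ is a continuous linear operator $F(\omega)$ on $X$ such that $f(\bar x(\omega)+h,\omega)=f(\bar x(\omega),\omega)+F(\omega)h+g(h,\omega)\|h\|$ for $h\in X$, with $g(h,\omega)\to0$ as $\|h\|\to0$; its norm is $\|F\|=\sup\{\|Fh\|/\|h\|:0\ne h\in X\}$. *)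

theory Defs
  imports "HOL-Probability.Probability"
begin

text \<open>
  Discrete and continuous time are treated uniformly: the time set \<open>TT\<close> is a set of reals,
  either \<open>\<nat>\<close> or \<open>{0..}\<close>. Families indexed by time are functions on all reals of which
  only the values at times in \<open>TT\<close> are constrained.
\<close>

definition measure_preserving_map :: "'w measure \<Rightarrow> ('w \<Rightarrow> 'w) \<Rightarrow> bool" where
  "measure_preserving_map P S \<longleftrightarrow>
     S \<in> P \<rightarrow>\<^sub>M P \<and> (\<forall>A\<in>sets P. emeasure P (S -` A \<inter> space P) = emeasure P A)"

definition ergodic_map :: "'w measure \<Rightarrow> ('w \<Rightarrow> 'w) \<Rightarrow> bool" where
  "ergodic_map P S \<longleftrightarrow>
     (\<forall>A\<in>sets P. S -` A \<inter> space P = A \<longrightarrow> emeasure P A = 0 \<or> emeasure P A = 1)"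

locale ergodic_semigroup = prob_space P
  for P :: "'w measure" +
  fixes TT :: "real set" and T :: "real \<Rightarrow> 'w \<Rightarrow> 'w"
  assumes time: "TT = \<nat> \<or> TT = {0..}"
    and preserving: "\<And>t. t \<in> TT \<Longrightarrow> measure_preserving_map P (T t)"
    and semigroup_0: "\<And>\<omega>. \<omega> \<in> space P \<Longrightarrow> T 0 \<omega> = \<omega>"
    and semigroup_add: "\<And>t s \<omega>. t \<in> TT \<Longrightarrow> s \<in> TT \<Longrightarrow> \<omega> \<in> space P \<Longrightarrow>
          T (t + s) \<omega> = T t (T s \<omega>)"
    and ergodic: "\<And>t. t \<in> TT \<Longrightarrow> t > 0 \<Longrightarrow> ergodic_map P (T t)"

text \<open>
  A cocycle \<open>C\<close> over the semigroup on a metric space, an equilibrium path \<open>xbar\<close>, and a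
  forward invariant random set \<open>XX\<close> containing the equilibrium. The order of arguments
  is \<open>C t x \<omega>\<close> and \<open>xbar t \<omega>\<close>.
\<close>

locale cocycle_with_equilibrium = ergodic_semigroup P TT T
  for P :: "'w measure" and TT :: "real set" and T :: "real \<Rightarrow> 'w \<Rightarrow> 'w" +
  fixes C :: "real \<Rightarrow> 'x::metric_space \<Rightarrow> 'w \<Rightarrow> 'x"
    and xbar :: "real \<Rightarrow> 'w \<Rightarrow> 'x"
    and XX :: "'w \<Rightarrow> 'x set"
  assumes C_measurable: "\<And>t. t \<in> TT \<Longrightarrow> (\<lambda>(x, \<omega>). C t x \<omega>) \<in> borel \<Otimes>\<^sub>M P \<rightarrow>\<^sub>M borel"
    and C_0: "\<And>x \<omega>. \<omega> \<in> space P \<Longrightarrow> C 0 x \<omega> = x"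
    and C_add: "\<And>t s x \<omega>. t \<in> TT \<Longrightarrow> s \<in> TT \<Longrightarrow> \<omega> \<in> space P \<Longrightarrow>
          C (t + s) x \<omega> = C s (C t x \<omega>) (T t \<omega>)"
    and xbar_measurable: "\<And>t. t \<in> TT \<Longrightarrow> xbar t \<in> P \<rightarrow>\<^sub>M borel"
    and equilibrium: "AE \<omega> in P. \<forall>t\<in>TT. xbar t \<omega> = C t (xbar 0 \<omega>) \<omega> \<and> xbar t \<omega> = xbar 0 (T t \<omega>)"
    and random_set: "{(u, \<omega>). \<omega> \<in> space P \<and> u \<in> XX \<omega>} \<in> sets (borel \<Otimes>\<^sub>M P)"
    and xbar_in: "\<And>\<omega>. \<omega> \<in> space P \<Longrightarrow> xbar 0 \<omega> \<in> XX \<omega>"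
    and invariant: "\<And>t \<omega> x. t \<in> TT \<Longrightarrow> \<omega> \<in> space P \<Longrightarrow> x \<in> XX \<omega> \<Longrightarrow> C t x \<omega> \<in> XX (T t \<omega>)"

definition local_ball :: "('w \<Rightarrow> 'x::metric_space set) \<Rightarrow> ('w \<Rightarrow> 'x) \<Rightarrow> 'w \<Rightarrow> real \<Rightarrow> 'x set" where
  "local_ball XX x0 \<omega> \<delta> = {x \<in> XX \<omega>. dist x (x0 \<omega>) \<le> \<delta>}"

definition pos_random_variable :: "'w measure \<Rightarrow> ('w \<Rightarrow> real) \<Rightarrow> bool" where
  "pos_random_variable P L \<longleftrightarrow> L \<in> borel_measurable P \<and> (\<forall>\<omega>\<in>space P. L \<omega> > 0)"

text \<open>\<open>E |ln L| < \<infinity>\<close> for a positive random variable \<open>L\<close>:\<close>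

definition log_integrable :: "'w measure \<Rightarrow> ('w \<Rightarrow> real) \<Rightarrow> bool" where
  "log_integrable P L \<longleftrightarrow> pos_random_variable P L \<and> integrable P (\<lambda>\<omega>. ln (L \<omega>))"

text \<open>Logarithm of a nonnegative real with the convention \<open>ln 0 = -\<infinity>\<close> (in HOL, \<open>ln 0 = 0\<close>).\<close>

definition eln :: "real \<Rightarrow> ereal" where
  "eln x = (if x = 0 then -\<infinity> else ereal (ln x))"

text \<open>
  The expectation as the difference of the expectations of positive and negative part.
  Since \<open>\<infinity> - \<infinity> = \<infinity>\<close> in \<^typ>\<open>ereal\<close>, a value less than \<open>0\<close> entails that the positive part has
  finite expectation, i.e. that the expectation is well defined in \<open>[-\<infinity>, \<infinity>)\<close>.
\<close>

definition ereal_expectation :: "'w measure \<Rightarrow> ('w \<Rightarrow> ereal) \<Rightarrow> ereal" where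
  "ereal_expectation P g =
     enn2ereal (\<integral>\<^sup>+ \<omega>. e2ennreal (g \<omega>) \<partial>P) - enn2ereal (\<integral>\<^sup>+ \<omega>. e2ennreal (- g \<omega>) \<partial>P)"

definition lipschitz_at_equilibrium ::
  "'w measure \<Rightarrow> ('x::metric_space \<Rightarrow> 'w \<Rightarrow> 'x) \<Rightarrow> ('w \<Rightarrow> 'x) \<Rightarrow> ('w \<Rightarrow> 'x set) \<Rightarrow>
     ('w \<Rightarrow> real) \<Rightarrow> ('w \<Rightarrow> real) \<Rightarrow> bool" where
  "lipschitz_at_equilibrium P f x0 XX L \<delta> \<longleftrightarrow>
     log_integrable P L \<and> log_integrable P \<delta> \<and>
     (\<forall>\<omega>\<in>space P. \<forall>x\<in>local_ball XX x0 \<omega> (\<delta> \<omega>).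
        dist (f x \<omega>) (f (x0 \<omega>) \<omega>) \<le> L \<omega> * dist x (x0 \<omega>))"

text \<open>
  The two alternative contraction conditions on the time-\<open>M\<close> map \<open>f\<close>. The class
  \<^class>\<open>polish_space\<close> is that of complete separable metric spaces; separability of the Banach space
  is likewise expressed by the class \<^class>\<open>second_countable_topology\<close>.
\<close>

definition contraction_A ::
  "'w measure \<Rightarrow> ('x::polish_space \<Rightarrow> 'w \<Rightarrow> 'x) \<Rightarrow> ('w \<Rightarrow> 'x) \<Rightarrow> ('w \<Rightarrow> 'x set) \<Rightarrow> bool" where
  "contraction_A P f x0 XX \<longleftrightarrow>
     (\<exists>L \<delta>. lipschitz_at_equilibrium P f x0 XX L \<delta> \<and> (\<integral>\<omega>. ln (L \<omega>) \<partial>P) < 0)"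

definition contraction_B ::
  "'w measure \<Rightarrow> ('x::{banach, second_countable_topology} \<Rightarrow> 'w \<Rightarrow> 'x) \<Rightarrow> ('w \<Rightarrow> 'x) \<Rightarrow>
     ('w \<Rightarrow> 'x set) \<Rightarrow> bool" where
  "contraction_B P f x0 XX \<longleftrightarrow>
     (\<exists>L \<delta>. lipschitz_at_equilibrium P f x0 XX L \<delta>) \<and>
     (\<exists>F. (\<forall>\<omega>\<in>space P. ((\<lambda>x. f x \<omega>) has_derivative F \<omega>) (at (x0 \<omega>))) \<and>
          ereal_expectation P (\<lambda>\<omega>. eln (onorm (F \<omega>))) < 0)"

definition hoelder_up_to ::
  "'w measure \<Rightarrow> real set \<Rightarrow> (real \<Rightarrow> 'x::metric_space \<Rightarrow> 'w \<Rightarrow> 'x) \<Rightarrow> ('w \<Rightarrow> 'x) \<Rightarrow>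
     ('w \<Rightarrow> 'x set) \<Rightarrow> real \<Rightarrow> bool" where
  "hoelder_up_to P TT C x0 XX M \<longleftrightarrow>
     (\<exists>H \<kappa> b. log_integrable P H \<and> log_integrable P \<kappa> \<and> b > 0 \<and>
        (AE \<omega> in P. \<forall>x\<in>local_ball XX x0 \<omega> (\<kappa> \<omega>). \<forall>t\<in>TT. 0 \<le> t \<and> t \<le> M \<longrightarrow>
           dist (C t x \<omega>) (C t (x0 \<omega>) \<omega>) \<le> H \<omega> * dist x (x0 \<omega>) powr b))"

definition locally_exponentially_stable ::
  "'w measure \<Rightarrow> real set \<Rightarrow> (real \<Rightarrow> 'x::metric_space \<Rightarrow> 'w \<Rightarrow> 'x) \<Rightarrow> (real \<Rightarrow> 'w \<Rightarrow> 'x) \<Rightarrow>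
     ('w \<Rightarrow> 'x set) \<Rightarrow> bool" where
  "locally_exponentially_stable P TT C xbar XX \<longleftrightarrow>
     (\<exists>\<gamma> d. pos_random_variable P \<gamma> \<and> d < 0 \<and>
        (AE \<omega> in P. \<forall>a\<in>local_ball XX (xbar 0) \<omega> (\<gamma> \<omega>).
           Limsup (inf at_top (principal TT))
             (\<lambda>t. ereal (1 / t) * eln (dist (C t a \<omega>) (xbar t \<omega>))) \<le> ereal d))"

end

theory Submission
  imports Defs
begin

text \<open>
  Put \<open>S = T\<^sup>M\<close>. A real random variable with negative mean has Birkhoff sums that are almost surely
  bounded above: otherwise, by ergodicity, the running maxima \<open>m\<^sub>n\<close> of the sums diverge almost
  surely, so \<open>m\<^sub>n\<^sub>+\<^sub>1 - m\<^sub>n \<circ> S\<close>, whose mean is nonnegative, converges dominatedly to the variable.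
  This gives the exponential decay of the products of the Lipschitz constants along an orbit and the
  subexponential variation of \<open>\<delta>\<close>, \<open>\<kappa>\<close> and \<open>H\<close>, which is all that case (A) needs.

  In case (B), the Lipschitz constant is replaced by one close to the norm of the derivative, except
  with small probability. The set of \<open>\<omega>\<close> for which the derivative does not control the increments at
  a given scale is the projection of a measurable subset of the product space. It need not be
  measurable, but by the measurable projection theorem it is so up to a null set.
\<close>

subsection \<open>Birkhoff sums\<close>

text \<open>In case (B) the derivative controls the increments on some ball around the equilibrium,
  but nothing bounds the expected logarithm of its radius. The argument for case (A) needs a
  log-integrable radius, because it relies on the radius varying subexponentially along orbits. The
  radius is therefore frozen at a constant \<open>1/(n+1)\<close>, and where this is too large the
  given pair \<open>L\<close>, \<delta> is kept. The sets where it is too large shrink to a null set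
  as \<open>n\<close> grows, so integrability of \<open>ln L\<close> makes their share of the mean
  disappear in the limit. These sets decide which pair is used, so they have to be measurable. They
  are defined by the existence of a bad point \<open>x\<close>, and \<open>x\<close> cannot be
  restricted to a countable dense set: \<open>f\<close> is jointly measurable, but continuity in
  \<open>x\<close> is known only at the equilibrium. This forces the use of projections. Only linear
  bounds on Birkhoff sums with a slack in the slope are required, so one-sided boundedness takes the
  place of the pointwise ergodic theorem.\<close>

lemma measure_preserving_map_distr:
  assumes "measure_preserving_map P S"
  shows "distr P P S = P"
  using assms by (intro measure_eqI) (auto simp: measure_preserving_map_def emeasure_distr)

lemma measure_preserving_map_AE:
  assumes S: "measure_preserving_map P S" and "AE x in P. Q x"
  shows "AE x in P. Q (S x)"
proof -
  have "AE x in distr P P S. Q x"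
    unfolding measure_preserving_map_distr[OF S] by (rule assms(2))
  moreover have "S \<in> P \<rightarrow>\<^sub>M P"
    using S by (simp add: measure_preserving_map_def)
  ultimately show ?thesis
    using AE_distrD by blast
qed

lemma measure_preserving_map_integral:
  fixes g :: "'w \<Rightarrow> real"
  assumes S: "measure_preserving_map P S" and g: "integrable P g"
  shows "integrable P (\<lambda>x. g (S x))" "(\<integral>x. g (S x) \<partial>P) = (\<integral>x. g x \<partial>P)"
proof -
  have m: "S \<in> P \<rightarrow>\<^sub>M P"
    using S by (simp add: measure_preserving_map_def)
  have gm: "g \<in> borel_measurable P" using g by simp
  show "integrable P (\<lambda>x. g (S x))"
    using integrable_distr_eq[OF m gm] measure_preserving_map_distr[OF S] g by simp
  show "(\<integral>x. g (S x) \<partial>P) = (\<integral>x. g x \<partial>P)"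
    using integral_distr[OF m gm] measure_preserving_map_distr[OF S] by simp
qed

text \<open>This is the maximum over \<open>k \<le> n\<close> of the sums of \<open>g\<close> over
  the first \<open>k\<close> orbit points. The recursion peels off the first orbit point rather than
  the last, which relates the value at \<open>x\<close> directly to the value at
  \<open>S x\<close>.\<close>

primrec max_birkhoff_sum :: "('w \<Rightarrow> 'w) \<Rightarrow> ('w \<Rightarrow> real) \<Rightarrow> nat \<Rightarrow> 'w \<Rightarrow> real" where
  "max_birkhoff_sum S g 0 x = 0"
| "max_birkhoff_sum S g (Suc n) x = max 0 (g x + max_birkhoff_sum S g n (S x))"

lemma max_birkhoff_sum_nonneg: "0 \<le> max_birkhoff_sum S g n x"
  by (cases n) auto

lemma max_birkhoff_sum_Suc_mono: "max_birkhoff_sum S g n x \<le> max_birkhoff_sum S g (Suc n) x"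
proof (induction n arbitrary: x)
  case (Suc n)
  show ?case using Suc[of "S x"] by auto
qed auto

lemma incseq_max_birkhoff_sum: "incseq (\<lambda>n. max_birkhoff_sum S g n x)"
  using max_birkhoff_sum_Suc_mono by (intro incseq_SucI)

lemma birkhoff_sum_le_max: "(\<Sum>i<n. g ((S ^^ i) x)) \<le> max_birkhoff_sum S g n x"
proof (induction n arbitrary: x)
  case (Suc n)
  have "(\<Sum>i<Suc n. g ((S ^^ i) x)) = g x + (\<Sum>i<n. g ((S ^^ i) (S x)))"
    by (simp add: sum.lessThan_Suc_shift funpow_swap1 del: sum.lessThan_Suc)
  also have "\<dots> \<le> g x + max_birkhoff_sum S g n (S x)"
    using Suc[of "S x"] by simp
  finally show ?case by simp
qed auto

lemma integrable_max_birkhoff_sum: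
  assumes S: "measure_preserving_map P S" and g: "integrable P g"
  shows "integrable P (max_birkhoff_sum S g n)"
proof (induction n)
  case (Suc n)
  have "integrable P (\<lambda>x. max 0 (g x + max_birkhoff_sum S g n (S x)))"
    using measure_preserving_map_integral(1)[OF S Suc] g
    by (intro Bochner_Integration.integrable_max integrable_zero Bochner_Integration.integrable_add)
  then show ?case by simp
qed simp

lemma birkhoff_sums_bounded_above:
  fixes g :: "'w \<Rightarrow> real"
  assumes P: "prob_space P" and S: "measure_preserving_map P S" and erg: "ergodic_map P S"
    and g: "integrable P g" and neg: "(\<integral>x. g x \<partial>P) < 0"
  shows "AE x in P. \<exists>K. \<forall>n. (\<Sum>i<n. g ((S ^^ i) x)) \<le> K"
proof -
  interpret prob_space P by (rule P)
  let ?m = "max_birkhoff_sum S g"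
  have Sm [measurable]: "S \<in> P \<rightarrow>\<^sub>M P"
    using S by (simp add: measure_preserving_map_def)
  have mi: "integrable P (?m n)" for n
    by (rule integrable_max_birkhoff_sum[OF S g])
  have mm [measurable]: "?m n \<in> borel_measurable P" for n
    using mi by simp
  \<comment> \<open>The event that the maxima are unbounded. Passing from \<open>x\<close> to
    \<open>S x\<close> shifts them by a finite amount, so the event is exactly invariant, as
    \<open>ergodic_map\<close> demands, and not just up to a null set.\<close>
  define E where "E = {x \<in> space P. \<forall>K::nat. \<exists>n. ?m n x > real K}"
  have E [measurable]: "E \<in> sets P"
    unfolding E_def by measurable
  have "S -` E \<inter> space P = E"
  proof (intro set_eqI iffI)
    fix x assume "x \<in> S -` E \<inter> space P"
    then have x: "x \<in> space P" and u: "\<And>K::nat. \<exists>n. ?m n (S x) > real K"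
      by (auto simp: E_def)
    have "\<exists>n. ?m n x > real K" for K :: nat
    proof -
      obtain N :: nat where N: "real K + \<bar>g x\<bar> \<le> real N"
        using real_arch_simple by blast
      obtain n where n: "?m n (S x) > real N" using u by blast
      have "?m (Suc n) x > real K" using N n by (auto simp: max_def)
      then show ?thesis by blast
    qed
    with x show "x \<in> E" by (simp add: E_def)
  next
    fix x assume "x \<in> E"
    then have x: "x \<in> space P" and u: "\<And>K::nat. \<exists>n. ?m n x > real K"
      by (auto simp: E_def)
    have "\<exists>n. ?m n (S x) > real K" for K :: nat
    proof -
      obtain N :: nat where N: "real K + \<bar>g x\<bar> \<le> real N"
        using real_arch_simple by blast
      obtain n where n: "?m n x > real N" using u by blast
      then have "n \<noteq> 0" using N by (cases n) auto
      then obtain n' where "n = Suc n'" using not0_implies_Suc by blast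
      with n N have "?m n' (S x) > real K" by (auto simp: max_def split: if_splits)
      then show ?thesis by blast
    qed
    moreover have "S x \<in> space P" using x Sm by (rule measurable_space[rotated])
    ultimately show "x \<in> S -` E \<inter> space P" using x by (simp add: E_def)
  qed
  then have "emeasure P E = 0 \<or> emeasure P E = 1"
    using erg E unfolding ergodic_map_def by blast
  moreover have "emeasure P E \<noteq> 1"
  proof
    assume "emeasure P E = 1"
    then have "AE x in P. x \<in> E"
      using AE_in_set_eq_1[OF E] by (simp add: emeasure_eq_measure)
    then have ES: "AE x in P. S x \<in> E"
      by (rule measure_preserving_map_AE[OF S])
    let ?d = "\<lambda>n x. ?m (Suc n) x - ?m n (S x)"
    have "(\<lambda>n. \<integral>x. ?d n x \<partial>P) \<longlonglongrightarrow> (\<integral>x. g x \<partial>P)"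
    proof (rule integral_dominated_convergence[where w = "\<lambda>x. \<bar>g x\<bar>"])
      show "AE x in P. (\<lambda>n. ?d n x) \<longlonglongrightarrow> g x"
        using ES
      proof eventually_elim
        case (elim x)
        obtain N :: nat where N: "\<bar>g x\<bar> \<le> real N"
          using real_arch_simple by blast
        obtain n0 where n0: "?m n0 (S x) > real N"
          using elim by (auto simp: E_def)
        \<comment> \<open>Once \<open>?m n (S x)\<close> exceeds \<open>\<bar>g x\<bar>\<close>, the
          maximum with 0 in the recursion is attained by the other argument.\<close>
        have "?d n x = g x" if "n \<ge> n0" for n
        proof -
          have "?m n0 (S x) \<le> ?m n (S x)"
            using that by (rule incseqD[OF incseq_max_birkhoff_sum])
          then show ?thesis using n0 N by (auto simp: max_def)
        qed
        then have "\<forall>\<^sub>F n in sequentially. ?d n x = g x"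
          unfolding eventually_sequentially by blast
        then show ?case by (rule tendsto_eventually)
      qed
      \<comment> \<open>The difference is the maximum of \<open>g x\<close> and
        \<open>- ?m n (S x)\<close>, and the latter is at most 0.\<close>
      show "AE x in P. norm (?d n x) \<le> \<bar>g x\<bar>" for n
      proof (intro AE_I2)
        fix x
        show "norm (?d n x) \<le> \<bar>g x\<bar>"
          using max_birkhoff_sum_nonneg[of S g n "S x"] by (auto simp: max_def)
      qed
    qed (use g in auto)
    moreover have "(\<integral>x. ?d n x \<partial>P) \<ge> 0" for n
    proof -
      \<comment> \<open>Composition with \<open>S\<close> preserves the mean of \<open>?m n\<close>,
        so monotonicity in \<open>n\<close> decides the sign.\<close>
      have "(\<integral>x. ?d n x \<partial>P) = (\<integral>x. ?m (Suc n) x \<partial>P) - (\<integral>x. ?m n x \<partial>P)"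
        using mi measure_preserving_map_integral[OF S mi[of n]]
        by (subst Bochner_Integration.integral_diff) (auto simp del: max_birkhoff_sum.simps)
      moreover have "(\<integral>x. ?m n x \<partial>P) \<le> (\<integral>x. ?m (Suc n) x \<partial>P)"
        by (rule integral_mono[OF mi mi max_birkhoff_sum_Suc_mono])
      ultimately show ?thesis by simp
    qed
    ultimately have "(\<integral>x. g x \<partial>P) \<ge> 0"
      by (intro tendsto_lowerbound[of _ _ sequentially]) auto
    with neg show False by simp
  qed
  ultimately have "AE x in P. x \<notin> E"
    using E by (metis AE_iff_null_sets null_setsI)
  moreover have "AE x in P. x \<in> space P" by simp
  ultimately show ?thesis
  proof eventually_elim
    case (elim x)
    then obtain K :: nat where K: "\<And>n. ?m n x \<le> real K"
      by (auto simp: E_def not_less)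
    have "(\<Sum>i<n. g ((S ^^ i) x)) \<le> real K" for n
      using birkhoff_sum_le_max[where S = S and g = g and n = n and x = x] K[of n] by (rule order_trans)
    then show ?case by blast
  qed
qed

lemma birkhoff_sums_linear_bound:
  fixes g :: "'w \<Rightarrow> real"
  assumes P: "prob_space P" and S: "measure_preserving_map P S" and erg: "ergodic_map P S"
    and g: "integrable P g" and c: "(\<integral>x. g x \<partial>P) < c"
  shows "AE x in P. \<exists>K. \<forall>n. (\<Sum>i<n. g ((S ^^ i) x)) \<le> c * real n + K"
proof -
  interpret prob_space P by (rule P)
  have "AE x in P. \<exists>K. \<forall>n. (\<Sum>i<n. g ((S ^^ i) x) - c) \<le> K"
    using g c by (intro birkhoff_sums_bounded_above[OF P S erg]) (auto simp: prob_space)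
  then show ?thesis
    by eventually_elim (simp add: sum_subtractf algebra_simps)
qed

text \<open>The term at \<open>n\<close> is the difference of the sums of
  \<open>\<bar>g\<bar>\<close> of lengths \<open>n + 1\<close> and \<open>n\<close>. The first has
  upper slope \<open>?I + e / 2\<close> and the second lower slope \<open>?I - e / 2\<close>, which
  leaves slope \<open>e\<close>.\<close>

lemma orbit_sublinear_growth:
  fixes g :: "'w \<Rightarrow> real"
  assumes P: "prob_space P" and S: "measure_preserving_map P S" and erg: "ergodic_map P S"
    and g: "integrable P g" and e: "e > 0"
  shows "AE x in P. \<exists>K. \<forall>n. \<bar>g ((S ^^ n) x)\<bar> \<le> e * real n + K"
proof -
  let ?h = "\<lambda>x. \<bar>g x\<bar>" and ?I = "\<integral>x. \<bar>g x\<bar> \<partial>P"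
  have h: "integrable P ?h" using g by simp
  have "AE x in P. \<exists>K. \<forall>n. (\<Sum>i<n. ?h ((S ^^ i) x)) \<le> (?I + e / 2) * real n + K"
    using e by (intro birkhoff_sums_linear_bound[OF P S erg h]) auto
  moreover have "AE x in P. \<exists>K. \<forall>n. (\<Sum>i<n. - ?h ((S ^^ i) x)) \<le> (- ?I + e / 2) * real n + K"
    using e h by (intro birkhoff_sums_linear_bound[OF P S erg]) auto
  ultimately show ?thesis
  proof eventually_elim
    case (elim x)
    then obtain K1 K2 where
      1: "\<And>n. (\<Sum>i<n. ?h ((S ^^ i) x)) \<le> (?I + e / 2) * real n + K1" and
      2: "\<And>n. (\<Sum>i<n. - ?h ((S ^^ i) x)) \<le> (- ?I + e / 2) * real n + K2"
      by blast
    have "?h ((S ^^ n) x) \<le> e * real n + (?I + e / 2 + K1 + K2)" for n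
      using 1[of "Suc n"] 2[of n] by (simp add: sum_negf algebra_simps add_divide_distrib)
    then show ?case by blast
  qed
qed

subsection \<open>Souslin schemes and measurable projection\<close>

definition seq_prefix :: "(nat \<Rightarrow> nat) \<Rightarrow> nat \<Rightarrow> nat list" where
  "seq_prefix z n = map z [0..<n]"

lemma length_seq_prefix [simp]: "length (seq_prefix z n) = n"
  by (simp add: seq_prefix_def)

lemma nth_seq_prefix [simp]: "i < n \<Longrightarrow> seq_prefix z n ! i = z i"
  by (simp add: seq_prefix_def)

lemma seq_prefix_Suc: "seq_prefix z (Suc n) = seq_prefix z n @ [z n]"
  by (simp add: seq_prefix_def)

lemma seq_prefix_Suc_case: "seq_prefix z (Suc n) = z 0 # seq_prefix (\<lambda>i. z (Suc i)) n"
  by (intro nth_equalityI) (auto simp: nth_Cons split: nat.split)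

lemma take_seq_prefix [simp]: "take m (seq_prefix z n) = seq_prefix z (min m n)"
  by (simp add: seq_prefix_def take_map min_def)

lemma seq_prefix_eq_Nil_iff [simp]: "seq_prefix z n = [] \<longleftrightarrow> n = 0"
  by (simp add: seq_prefix_def)

lemma seq_prefix_0 [simp]: "seq_prefix z 0 = []"
  by simp

lemma last_seq_prefix_Suc [simp]: "last (seq_prefix z (Suc n)) = z n"
  by (simp add: seq_prefix_Suc)

text \<open>This is the Souslin operation: the union over all infinite branches of the intersection
  along the branch. The value \<open>n = 0\<close> is included, so \<open>Q []\<close> is a
  constraint as well.\<close>

definition souslin :: "(nat list \<Rightarrow> 'a set) \<Rightarrow> 'a set" where
  "souslin Q = {p. \<exists>z. \<forall>n. p \<in> Q (seq_prefix z n)}"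

definition souslin_sets :: "'a set set \<Rightarrow> 'a set set" where
  "souslin_sets \<E> = {souslin Q | Q. \<forall>s. Q s \<in> \<E>}"

lemma souslin_setsI: "(\<And>s. Q s \<in> \<E>) \<Longrightarrow> souslin Q \<in> souslin_sets \<E>"
  by (auto simp: souslin_sets_def)

lemma souslin_sets_base: "A \<in> \<E> \<Longrightarrow> A \<in> souslin_sets \<E>"
  using souslin_setsI[of "\<lambda>_. A" \<E>] by (simp add: souslin_def)

text \<open>
  A sequence \<open>z\<close> codes the sequences \<open>z\<^sub>i = (\<lambda>j. z (prod_encode (i, j)))\<close>; the condition on the
  prefix of length \<open>n\<close> of \<open>z\<^sub>i\<close> only involves the prefix of length \<open>prod_encode (i, n)\<close> of \<open>z\<close>.
\<close>

lemma prod_encode_less: "j < n \<Longrightarrow> prod_encode (i, j) < prod_encode (i, n)"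
proof (induction n)
  case (Suc n)
  then show ?case by (cases "j = n") (auto simp: prod_encode_def)
qed simp

definition souslin_merge :: "(nat \<Rightarrow> nat list \<Rightarrow> 'a set) \<Rightarrow> nat list \<Rightarrow> 'a set" where
  "souslin_merge Q s = (case prod_decode (length s) of
     (i, n) \<Rightarrow> Q i (map (\<lambda>j. s ! prod_encode (i, j)) [0..<n]))"

lemma souslin_merge_seq_prefix:
  "souslin_merge Q (seq_prefix z (prod_encode (i, n))) = Q i (seq_prefix (\<lambda>j. z (prod_encode (i, j))) n)"
proof -
  have "map (\<lambda>j. seq_prefix z (prod_encode (i, n)) ! prod_encode (i, j)) [0..<n] =
      seq_prefix (\<lambda>j. z (prod_encode (i, j))) n"
    by (intro nth_equalityI) (auto simp: prod_encode_less)
  then show ?thesis by (simp add: souslin_merge_def)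
qed

lemma souslin_merge: "souslin (souslin_merge Q) = (\<Inter>i. souslin (Q i))"
proof (intro set_eqI iffI)
  fix p assume "p \<in> souslin (souslin_merge Q)"
  then obtain z where z: "\<And>m. p \<in> souslin_merge Q (seq_prefix z m)"
    by (auto simp: souslin_def)
  have "p \<in> Q i (seq_prefix (\<lambda>j. z (prod_encode (i, j))) n)" for i n
    using z[of "prod_encode (i, n)"] by (simp add: souslin_merge_seq_prefix)
  then show "p \<in> (\<Inter>i. souslin (Q i))"
    unfolding souslin_def by blast
next
  fix p assume "p \<in> (\<Inter>i. souslin (Q i))"
  then have "\<forall>i. \<exists>z. \<forall>n. p \<in> Q i (seq_prefix z n)"
    by (auto simp: souslin_def)
  from choice[OF this] obtain z where z: "\<And>i n. p \<in> Q i (seq_prefix (z i) n)"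
    by blast
  define w where "w m = (case prod_decode m of (i, j) \<Rightarrow> z i j)" for m
  have "p \<in> souslin_merge Q (seq_prefix w m)" for m
  proof -
    obtain i n where m: "m = prod_encode (i, n)"
      by (metis prod_decode_inverse surj_pair)
    show ?thesis
      unfolding m souslin_merge_seq_prefix using z[of i n] by (simp add: w_def)
  qed
  then show "p \<in> souslin (souslin_merge Q)"
    unfolding souslin_def by blast
qed

section \<open>Closure of the Souslin sets under countable intersections and unions\<close>

lemma souslin_sets_schemes:
  assumes "\<And>i. B i \<in> souslin_sets \<E>"
  shows "\<exists>Q. \<forall>i. B i = souslin (Q i) \<and> (\<forall>s. Q i s \<in> \<E>)"
proof (rule choice)
  show "\<forall>i. \<exists>Q. B i = souslin Q \<and> (\<forall>s. Q s \<in> \<E>)"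
    using assms by (simp add: souslin_sets_def)
qed

lemma souslin_sets_INT:
  assumes B: "\<And>i::nat. B i \<in> souslin_sets \<E>"
  shows "(\<Inter>i. B i) \<in> souslin_sets \<E>"
proof -
  obtain Q where "\<forall>i. B i = souslin (Q i) \<and> (\<forall>s. Q i s \<in> \<E>)"
    using souslin_sets_schemes[of B, OF B] by (rule exE)
  then have Q: "\<And>i s. Q i s \<in> \<E>" "\<And>i. B i = souslin (Q i)"
    by simp_all
  have "souslin_merge Q s \<in> \<E>" for s
    using Q(1) by (simp add: souslin_merge_def split: prod.split)
  then show ?thesis
    unfolding Q(2) souslin_merge[symmetric] by (rule souslin_setsI)
qed

text \<open>The first entry of a branch selects the index \<open>i\<close>, and the remaining
  entries form the branch for \<open>Q i\<close>. The empty sequence carries no index yet, so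
  \<Omega> is placed there.\<close>

lemma souslin_sets_UN:
  assumes B: "\<And>i::nat. B i \<in> souslin_sets \<E>" and top: "\<Omega> \<in> \<E>" "\<E> \<subseteq> Pow \<Omega>"
  shows "(\<Union>i. B i) \<in> souslin_sets \<E>"
proof -
  obtain Q where "\<forall>i. B i = souslin (Q i) \<and> (\<forall>s. Q i s \<in> \<E>)"
    using souslin_sets_schemes[of B, OF B] by (rule exE)
  then have Q: "\<And>i s. Q i s \<in> \<E>" "\<And>i. B i = souslin (Q i)"
    by simp_all
  define R where "R s = (case s of [] \<Rightarrow> \<Omega> | i # s' \<Rightarrow> Q i s')" for s
  have R0: "R [] = \<Omega>" and R1: "R (i # s) = Q i s" for i s
    by (auto simp: R_def)
  have "(\<Union>i. B i) = souslin R"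
  proof (intro set_eqI iffI)
    fix p assume "p \<in> (\<Union>i. B i)"
    then obtain i z where z: "\<And>n. p \<in> Q i (seq_prefix z n)"
      by (auto simp: Q souslin_def)
    then have "p \<in> \<Omega>" using Q(1) top(2) by blast
    then have "p \<in> R (seq_prefix (case_nat i z) n)" for n
      using z by (cases n) (auto simp: seq_prefix_Suc_case R0 R1)
    then show "p \<in> souslin R"
      unfolding souslin_def by blast
  next
    fix p assume "p \<in> souslin R"
    then obtain z where z: "\<And>n. p \<in> R (seq_prefix z n)"
      by (auto simp: souslin_def)
    have "p \<in> Q (z 0) (seq_prefix (\<lambda>i. z (Suc i)) n)" for n
      using z[of "Suc n"] by (simp add: seq_prefix_Suc_case R1)
    then show "p \<in> (\<Union>i. B i)"
      by (auto simp: Q souslin_def)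
  qed
  moreover have "R s \<in> \<E>" for s
    using Q(1) top(1) by (simp add: R_def split: list.split)
  ultimately show ?thesis by (simp add: souslin_setsI)
qed

text \<open>Souslin sets need not be closed under complements, so the induction carries a set and
  its complement together. Complementation swaps the two, and a countable union becomes a countable
  intersection on the complementary side.\<close>

lemma sigma_sets_subset_souslin_sets:
  assumes top: "\<Omega> \<in> \<E>" "\<E> \<subseteq> Pow \<Omega>"
    and G: "\<And>A. A \<in> G \<Longrightarrow> A \<in> souslin_sets \<E> \<and> \<Omega> - A \<in> souslin_sets \<E>" "G \<subseteq> Pow \<Omega>"
    and e: "{} \<in> \<E>"
    and A: "A \<in> sigma_sets \<Omega> G"
  shows "A \<in> souslin_sets \<E> \<and> \<Omega> - A \<in> souslin_sets \<E>"
  using A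
proof induction
  case (Basic a)
  then show ?case by (rule G(1))
next
  case Empty
  then show ?case using e top(1) by (simp add: souslin_sets_base)
next
  case (Compl a)
  have "a \<subseteq> \<Omega>" using Compl.hyps G(2) by (meson sigma_sets_into_sp)
  then show ?case using Compl.IH by (simp add: double_diff)
next
  case (Union a)
  have "\<Omega> - (\<Union>i. a i) = (\<Inter>i. \<Omega> - a i)" by blast
  then show ?case
    using Union.IH souslin_sets_UN[OF _ top, of a] souslin_sets_INT[of "\<lambda>i. \<Omega> - a i" \<E>] by simp
qed

text \<open>Koenig's lemma: the sequences bounded by \<open>k\<close> form a finitely branching
  tree, and admissible nodes at every level yield an infinite admissible branch.\<close>

lemma souslin_bounded_branch:
  assumes "\<And>n. \<exists>s. length s = n \<and> (\<forall>i<n. s ! i \<le> k i) \<and> (\<forall>m\<le>n. p \<in> W (take m s))"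
  shows "p \<in> souslin W"
proof -
  \<comment> \<open>A node is good if it has admissible extensions of every length, that is, if an
    infinite subtree lies above it.\<close>
  define good where "good s \<longleftrightarrow> (\<forall>n\<ge>length s. \<exists>t. length t = n \<and> take (length s) t = s \<and>
      (\<forall>i<n. t ! i \<le> k i) \<and> (\<forall>m\<le>n. p \<in> W (take m t)))" for s
  have goodD: "\<exists>t. length t = n \<and> take (length s) t = s \<and>
      (\<forall>i<n. t ! i \<le> k i) \<and> (\<forall>m\<le>n. p \<in> W (take m t))" if "good s" "length s \<le> n" for s n
    using that by (simp add: good_def)
  have good_in: "p \<in> W s" if gs: "good s" for s
  proof -
    obtain t where "length t = length s" "take (length s) t = s" "\<forall>m\<le>length s. p \<in> W (take m t)"
      using goodD[OF gs order_refl] by blast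
    then show ?thesis by (metis take_all order_refl)
  qed
  have ext: "\<exists>j. good (s @ [j])" if s: "good s" for s
  proof (rule ccontr)
    assume "\<nexists>j. good (s @ [j])"
    define ext where "ext j n \<longleftrightarrow> (\<exists>t. length t = n \<and> take (Suc (length s)) t = s @ [j] \<and>
      (\<forall>i<n. t ! i \<le> k i) \<and> (\<forall>m\<le>n. p \<in> W (take m t)))" for j n
    have "\<forall>j. \<exists>n. n \<ge> Suc (length s) \<and> \<not> ext j n"
      using \<open>\<nexists>j. good (s @ [j])\<close> unfolding good_def ext_def by simp
    from choice[OF this] obtain N where N: "\<And>j. N j \<ge> Suc (length s)" "\<And>j. \<not> ext j (N j)"
      by blast
    \<comment> \<open>If no child is good, each child \<open>j\<close> has no extension of some
      length \<open>N j\<close>. Only the children up to \<open>k (length s)\<close> matter, so the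
      maximum exists; an extension of \<open>s\<close> of that length, cut down to
      \<open>N j\<close> for its own child \<open>j\<close>, gives the contradiction.\<close>
    define n where "n = Max (N ` {..k (length s)})"
    have nN: "N j \<le> n" if "j \<le> k (length s)" for j
      using that by (auto simp: n_def)
    have ls: "length s < n" using N(1)[of 0] nN[of 0] by auto
    then obtain t where t: "length t = n" "take (length s) t = s"
      "\<forall>i<n. t ! i \<le> k i" "\<forall>m\<le>n. p \<in> W (take m t)"
      using goodD[OF s less_imp_le[OF ls]] by blast
    define j where "j = t ! length s"
    have j: "j \<le> k (length s)" using t(3) ls by (simp add: j_def)
    have tj: "take (Suc (length s)) t = s @ [j]"
      using t ls by (simp add: take_Suc_conv_app_nth j_def)
    have "ext j (N j)"
      unfolding ext_def
    proof (intro exI conjI)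
      show "length (take (N j) t) = N j" using nN[OF j] t(1) by simp
      show "take (Suc (length s)) (take (N j) t) = s @ [j]"
        using N(1)[of j] tj by (simp add: min_absorb1)
      show "\<forall>i<N j. take (N j) t ! i \<le> k i" using nN[OF j] t(3) by auto
      show "\<forall>m\<le>N j. p \<in> W (take m (take (N j) t))"
        using nN[OF j] t(4) by (auto simp: min_absorb1)
    qed
    with N(2) show False by blast
  qed
  define g where "g s = (SOME j. good (s @ [j]))" for s
  define l where "l = rec_nat [] (\<lambda>_ s. s @ [g s])"
  have l0: "l 0 = []" and lS: "\<And>n. l (Suc n) = l n @ [g (l n)]"
    by (auto simp: l_def)
  have "good []" using assms unfolding good_def by simp
  then have gl: "good (l n)" for n
  proof (induction n)
    case (Suc n)
    then show ?case using ext someI_ex[of "\<lambda>j. good (l n @ [j])"] by (simp add: lS g_def)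
  qed (simp add: l0)
  have l: "l n = seq_prefix (\<lambda>n. g (l n)) n" for n
    by (induction n) (simp_all add: l0 lS seq_prefix_Suc)
  have "p \<in> W (seq_prefix (\<lambda>n. g (l n)) n)" for n
    using good_in[OF gl[of n]] l[of n] by simp
  then show ?thesis
    unfolding souslin_def by blast
qed

text \<open>The capacitability argument. The entries of the branches are bounded one after another,
  at a total cost of at most \<open>e\<close> in outer measure. The bounded branches form a finitely
  branching tree, whose finite levels give a decreasing sequence of measurable sets with
  intersection inside \<open>souslin W\<close>.\<close>

lemma souslin_inner_approx:
  assumes M: "finite_measure M" and W: "\<And>s. W s \<in> sets M" and e: "(e::real) > 0"
  shows "\<exists>K\<in>sets M. K \<subseteq> souslin W \<and> outer_measure_of M (souslin W) \<le> emeasure M K + ennreal e"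
proof -
  interpret finite_measure M by (rule M)
  \<comment> \<open>The entries of the branch are bounded by those of \<open>s\<close>, not equal to
    them. This makes \<open>D (s @ [m])\<close> increase to \<open>D s\<close> with
    \<open>m\<close>, and outer measure is continuous along increasing sequences even of
    nonmeasurable sets.\<close>
  define D where "D s = {p. \<exists>z. (\<forall>i<length s. z i \<le> s ! i) \<and> (\<forall>n. p \<in> W (seq_prefix z n))}" for s
  have D0: "D [] = souslin W" by (simp add: D_def souslin_def)
  have Dsub: "D s \<subseteq> space M" for s
    using sets.sets_into_space[OF W] unfolding D_def by blast
  have Dfin: "outer_measure_of M A < top" if "A \<subseteq> space M" for A
    using outer_measure_of_mono[OF that, of M] emeasure_finite[of "space M"]
    by (auto simp: less_top[symmetric] top_unique)
  have step: "\<exists>m. outer_measure_of M (D s) \<le> outer_measure_of M (D (s @ [m])) + ennreal r"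
    if r: "r > 0" for s r
  proof -
    have bounds: "(\<forall>i<length (s @ [m]). z i \<le> (s @ [m]) ! i) \<longleftrightarrow>
        (\<forall>i<length s. z i \<le> s ! i) \<and> z (length s) \<le> m" for z m
      by (auto simp: nth_append less_Suc_eq)
    have D_snoc: "D (s @ [m]) = {p. \<exists>z. ((\<forall>i<length s. z i \<le> s ! i) \<and> z (length s) \<le> m) \<and>
        (\<forall>n. p \<in> W (seq_prefix z n))}" for m
      unfolding D_def bounds ..
    have "incseq (\<lambda>m. D (s @ [m]))"
      unfolding incseq_def D_snoc by (blast intro: order_trans)
    then have "(SUP m. outer_measure_of M (D (s @ [m]))) = outer_measure_of M (\<Union>m. D (s @ [m]))"
      using Dsub by (intro SUP_outer_measure_of_incseq) auto
    also have "(\<Union>m. D (s @ [m])) = D s"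
      unfolding D_snoc unfolding D_def by blast
    finally have sup: "(SUP m. outer_measure_of M (D (s @ [m]))) = outer_measure_of M (D s)" .
    show ?thesis
    proof (cases "outer_measure_of M (D s) = 0")
      case False
      then have "outer_measure_of M (D s) - ennreal r < outer_measure_of M (D s)"
        using r Dfin[OF Dsub] by (intro ennreal_between) (auto simp: zero_less_iff_neq_zero)
      then obtain m where "outer_measure_of M (D s) - ennreal r < outer_measure_of M (D (s @ [m]))"
        unfolding sup[symmetric] less_SUP_iff by blast
      then show ?thesis
        by (metis add.commute ennreal_minus_le_iff less_imp_le ennreal_neq_top)
    qed simp
  qed
  \<comment> \<open>The loss allowed at length \<open>n\<close> is \<open>e / 2 ^ (n + 1)\<close>,
    so that all losses together stay below \<open>e\<close>.\<close>
  define g where "g s = (SOME m. outer_measure_of M (D s) \<le>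
      outer_measure_of M (D (s @ [m])) + ennreal (e * (1/2) ^ Suc (length s)))" for s
  define l where "l = rec_nat [] (\<lambda>_ s. s @ [g s])"
  have l0: "l 0 = []" and lS: "\<And>n. l (Suc n) = l n @ [g (l n)]"
    by (auto simp: l_def)
  define k where "k n = g (l n)" for n
  have lk: "l n = seq_prefix k n" for n
    by (induction n) (simp_all add: l0 lS seq_prefix_Suc k_def)
  have gl: "outer_measure_of M (D (l n)) \<le>
      outer_measure_of M (D (l (Suc n))) + ennreal (e * (1/2) ^ Suc n)" for n
    using someI_ex[OF step[of "e * (1/2) ^ Suc (length (l n))" "l n"]] e
    unfolding g_def[symmetric] lS by (simp add: lk)
  have low: "outer_measure_of M (souslin W) \<le> outer_measure_of M (D (l n)) + ennreal (e * (1 - (1/2) ^ n))" for n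
  proof (induction n)
    case (Suc n)
    have "outer_measure_of M (souslin W) \<le>
        outer_measure_of M (D (l (Suc n))) + ennreal (e * (1/2) ^ Suc n) + ennreal (e * (1 - (1/2) ^ n))"
      using Suc gl[of n] by (meson add_right_mono order_trans)
    also have "\<dots> = outer_measure_of M (D (l (Suc n))) + (ennreal (e * (1/2) ^ Suc n) + ennreal (e * (1 - (1/2) ^ n)))"
      by (simp add: add.assoc)
    also have "ennreal (e * (1/2) ^ Suc n) + ennreal (e * (1 - (1/2) ^ n)) = ennreal (e * (1 - (1/2) ^ Suc n))"
      using e by (subst ennreal_plus[symmetric]) (auto simp: algebra_simps power_le_one)
    finally show ?case .
  qed (simp add: l0 D0)
  define S where "S n = {s. length s = n \<and> (\<forall>i<n. s ! i \<le> k i)}" for n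
  \<comment> \<open>The measurable approximation of level \<open>n\<close>: it tests only prefixes
    up to length \<open>n\<close>, and the bound \<open>k\<close> leaves finitely many sequences to
    unite. It contains \<open>D (l n)\<close>, so it inherits the lower bound on measure.\<close>
  define V where "V n = (\<Union>s\<in>S n. \<Inter>m\<in>{..n}. W (take m s))" for n
  have finS: "finite (S n)" for n
  proof (rule finite_subset)
    show "S n \<subseteq> {s. set s \<subseteq> {.. Max (k ` {..n})} \<and> length s = n}"
    proof
      fix s assume s: "s \<in> S n"
      have "x \<le> Max (k ` {..n})" if x: "x \<in> set s" for x
      proof -
        obtain i where i: "i < n" "x = s ! i" using x s by (auto simp: in_set_conv_nth S_def)
        then have "x \<le> k i" using s by (simp add: S_def)
        also have "k i \<le> Max (k ` {..n})" using i by (intro Max_ge) auto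
        finally show ?thesis .
      qed
      then show "s \<in> {s. set s \<subseteq> {.. Max (k ` {..n})} \<and> length s = n}"
        using s by (auto simp: S_def)
    qed
    show "finite {s. set s \<subseteq> {.. Max (k ` {..n})} \<and> length s = n}"
      by (rule finite_lists_length_eq) simp
  qed
  have Vm: "V n \<in> sets M" for n
    unfolding V_def using finS W by (intro sets.finite_UN sets.finite_INT) auto
  have "V (Suc n) \<subseteq> V n" for n
  proof
    fix p assume "p \<in> V (Suc n)"
    then obtain s where s: "s \<in> S (Suc n)" "\<And>m. m \<le> Suc n \<Longrightarrow> p \<in> W (take m s)"
      by (auto simp: V_def)
    have "take n s \<in> S n" using s(1) by (auto simp: S_def)
    moreover have "p \<in> W (take m (take n s))" if "m \<le> n" for m
      using s(2)[of m] that by (simp add: min_absorb1)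
    ultimately show "p \<in> V n" unfolding V_def by blast
  qed
  then have dec: "decseq V" by (intro decseq_SucI)
  have DV: "D (l n) \<subseteq> V n" for n
  proof
    fix p assume "p \<in> D (l n)"
    then obtain z where z: "\<forall>i<n. z i \<le> k i" "\<And>m. p \<in> W (seq_prefix z m)"
      by (auto simp: D_def lk)
    have "seq_prefix z n \<in> S n" using z(1) by (simp add: S_def)
    moreover have "p \<in> W (take m (seq_prefix z n))" if "m \<le> n" for m
      using z(2)[of m] that by (simp add: min_absorb1)
    ultimately show "p \<in> V n" unfolding V_def by blast
  qed
  have "outer_measure_of M (souslin W) \<le> emeasure M (V n) + ennreal e" for n
  proof -
    have "outer_measure_of M (souslin W) \<le> outer_measure_of M (D (l n)) + ennreal (e * (1 - (1/2) ^ n))"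
      by (rule low)
    also have "\<dots> \<le> outer_measure_of M (V n) + ennreal e"
      using e by (intro add_mono outer_measure_of_mono DV ennreal_leI) (auto simp: mult_le_cancel_left1)
    finally show ?thesis using Vm by simp
  qed
  moreover have "(\<lambda>n. emeasure M (V n) + ennreal e) \<longlonglongrightarrow> emeasure M (\<Inter>n. V n) + ennreal e"
    using Vm dec by (intro tendsto_add Lim_emeasure_decseq tendsto_const) auto
  ultimately have "outer_measure_of M (souslin W) \<le> emeasure M (\<Inter>n. V n) + ennreal e"
    by (intro LIMSEQ_le_const[of "\<lambda>n. emeasure M (V n) + ennreal e"]) auto
  moreover have "(\<Inter>n. V n) \<subseteq> souslin W"
  proof
    fix p assume p: "p \<in> (\<Inter>n. V n)"
    show "p \<in> souslin W"
    proof (rule souslin_bounded_branch)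
      fix n
      have "p \<in> V n" using p by blast
      then show "\<exists>s. length s = n \<and> (\<forall>i<n. s ! i \<le> k i) \<and> (\<forall>m\<le>n. p \<in> W (take m s))"
        by (auto simp: V_def S_def)
    qed
  qed
  moreover have "(\<Inter>n. V n) \<in> sets M" using Vm by blast
  ultimately show ?thesis by blast
qed

text \<open>A measurable hull attains the outer measure from outside. Inner approximations with loss
  \<open>1/(n+1)\<close> unite to a set of the same measure, and finiteness allows
  subtraction.\<close>

theorem souslin_measurable_up_to_null:
  assumes M: "finite_measure M" and W: "\<And>s. W s \<in> sets M"
  shows "\<exists>E\<in>sets M. \<exists>K\<in>sets M. K \<subseteq> souslin W \<and> souslin W \<subseteq> E \<and> E - K \<in> null_sets M"
proof -
  interpret finite_measure M by (rule M)
  have sub: "souslin W \<subseteq> space M"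
    using sets.sets_into_space[OF W] unfolding souslin_def by blast
  obtain E where E: "E \<in> sets M" "souslin W \<subseteq> E" "outer_measure_of M (souslin W) = emeasure M E"
    using outer_measure_of_attain[OF sub] by blast
  have "\<forall>n::nat. \<exists>K\<in>sets M. K \<subseteq> souslin W \<and> emeasure M E \<le> emeasure M K + ennreal (1 / real (Suc n))"
  proof
    fix n :: nat
    show "\<exists>K\<in>sets M. K \<subseteq> souslin W \<and> emeasure M E \<le> emeasure M K + ennreal (1 / real (Suc n))"
      using souslin_inner_approx[of M W "1 / real (Suc n)"] M W E(3) by simp
  qed
  then obtain K where K: "\<And>n::nat. K n \<in> sets M" "\<And>n. K n \<subseteq> souslin W"
    "\<And>n. emeasure M E \<le> emeasure M (K n) + ennreal (1 / real (Suc n))"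
    by metis
  let ?K = "\<Union>n. K n"
  have Ks: "?K \<in> sets M" "?K \<subseteq> souslin W" using K by auto
  have "emeasure M E \<le> emeasure M ?K + ennreal (1 / real (Suc n))" for n
    using K(3)[of n] emeasure_mono[of "K n" ?K M] Ks(1)
    by (meson UN_upper UNIV_I add_right_mono order_trans)
  moreover have "(\<lambda>n. emeasure M ?K + ennreal (1 / real (Suc n))) \<longlonglongrightarrow> emeasure M ?K + ennreal 0"
    using LIMSEQ_inverse_real_of_nat by (intro tendsto_add tendsto_const tendsto_ennrealI) (simp add: inverse_eq_divide)
  ultimately have "emeasure M E \<le> emeasure M ?K"
    by (intro LIMSEQ_le_const[of "\<lambda>n. emeasure M ?K + ennreal (1 / real (Suc n))"]) auto
  then have "emeasure M (E - ?K) = 0"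
    using E Ks by (subst emeasure_Diff) (auto simp: less_top[symmetric] diff_eq_0_iff_ennreal)
  then have "E - ?K \<in> null_sets M" using E Ks by (intro null_setsI) auto
  then show ?thesis using E Ks by blast
qed

section \<open>Product measurable sets as Souslin sets over closed rectangles\<close>

lemma souslin_sets_Int:
  assumes "A \<in> souslin_sets \<E>" "B \<in> souslin_sets \<E>"
  shows "A \<inter> B \<in> souslin_sets \<E>"
proof -
  have "(\<Inter>i::nat. if i = 0 then A else B) \<in> souslin_sets \<E>"
    using assms by (intro souslin_sets_INT) auto
  also have "(\<Inter>i::nat. if i = 0 then A else B) = A \<inter> B"
    by (auto split: if_splits)
  finally show ?thesis .
qed

lemma souslin_sets_Un:
  assumes "A \<in> souslin_sets \<E>" "B \<in> souslin_sets \<E>" "\<Omega> \<in> \<E>" "\<E> \<subseteq> Pow \<Omega>"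
  shows "A \<union> B \<in> souslin_sets \<E>"
proof -
  have "(\<Union>i::nat. if i = 0 then A else B) \<in> souslin_sets \<E>"
    using assms by (intro souslin_sets_UN) auto
  also have "(\<Union>i::nat. if i = 0 then A else B) = A \<union> B"
    by (auto split: if_splits)
  finally show ?thesis .
qed

lemma open_eq_UN_closed:
  fixes U :: "'x::metric_space set"
  assumes "open U"
  shows "\<exists>F::nat \<Rightarrow> 'x set. (\<forall>n. closed (F n)) \<and> U = (\<Union>n. F n)"
\<comment> \<open>The distance to the empty set is 0 by convention, so the sets \<open>?F n\<close>
  would be empty for \<open>U = UNIV\<close>.\<close>
proof (cases "U = UNIV")
  case True
  then show ?thesis by (intro exI[of _ "\<lambda>_. UNIV"]) auto
next
  case False
  let ?F = "\<lambda>n::nat. {x. 1 / real (Suc n) \<le> infdist x (- U)}"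
  have "closed (?F n)" for n
    by (intro closed_Collect_le continuous_intros)
  moreover have "U = (\<Union>n. ?F n)"
  proof (intro set_eqI iffI)
    fix x assume "x \<in> U"
    then have "infdist x (- U) > 0"
      using assms False in_closed_iff_infdist_zero[of "- U" x] infdist_nonneg[of x "- U"]
      by (auto simp: open_closed less_le)
    then obtain n :: nat where "1 / real (Suc n) < infdist x (- U)"
      using nat_approx_posE by blast
    then show "x \<in> (\<Union>n. ?F n)" by (auto intro: less_imp_le)
  next
    fix x assume "x \<in> (\<Union>n. ?F n)"
    then obtain n :: nat where n: "1 / real (Suc n) \<le> infdist x (- U)" by blast
    have "infdist x (- U) > 0" by (rule less_le_trans[OF _ n]) simp
    then show "x \<in> U" by (metis ComplI infdist_zero less_irrefl)
  qed
  ultimately show ?thesis by (intro exI[of _ ?F] conjI allI)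
qed

text \<open>First factors are closed, not merely Borel, so that completeness can supply a common
  point of a shrinking sequence of them.\<close>

definition closed_rectangles :: "'w measure \<Rightarrow> ('x::topological_space \<times> 'w) set set" where
  "closed_rectangles M = {F \<times> A | F A. closed F \<and> A \<in> sets M}"

lemma closed_rectanglesI: "closed F \<Longrightarrow> A \<in> sets M \<Longrightarrow> F \<times> A \<in> closed_rectangles M"
  by (auto simp: closed_rectangles_def)

text \<open>It suffices to treat measurable rectangles and their complements, which are built from
  cylinders. For a cylinder over a closed set the complement is a countable union of cylinders over
  closed sets; an induction over the Borel sets extends this to all first factors.\<close>

lemma product_sets_souslin:
  fixes B :: "('x::metric_space \<times> 'w) set"
  assumes "B \<in> sets (borel \<Otimes>\<^sub>M M)"
  shows "B \<in> souslin_sets (closed_rectangles M)"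
proof -
  let ?\<Omega> = "UNIV \<times> space M :: ('x \<times> 'w) set" and ?E = "closed_rectangles M :: ('x \<times> 'w) set set"
  have top: "?\<Omega> \<in> ?E" "?E \<subseteq> Pow ?\<Omega>"
    using sets.sets_into_space by (auto simp: closed_rectangles_def)
  have e: "{} \<in> ?E"
    using closed_rectanglesI[of "{}::'x set" "{}" M] by simp
  have cyl: "a \<times> space M \<in> souslin_sets ?E \<and> (- a) \<times> space M \<in> souslin_sets ?E"
    if "a \<in> sets borel" for a :: "'x set"
  proof -
    have "a \<in> sigma_sets UNIV (Collect closed)"
      using that by (simp add: borel_eq_closed)
    then show ?thesis
    proof induction
      case (Basic a)
      then have "open (- a)" by (simp add: open_Compl)
      then obtain F :: "nat \<Rightarrow> 'x set" where F: "\<And>n. closed (F n)" "- a = (\<Union>n. F n)"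
        using open_eq_UN_closed[of "- a"] by blast
      have "(\<Union>n. F n \<times> space M) \<in> souslin_sets ?E"
        using F(1) by (intro souslin_sets_UN[OF _ top] souslin_sets_base closed_rectanglesI) auto
      also have "(\<Union>n. F n \<times> space M) = (- a) \<times> space M"
        unfolding F(2) by blast
      finally show ?case
        using Basic by (auto intro!: souslin_sets_base closed_rectanglesI)
    next
      case Empty
      then show ?case using e top by (simp add: souslin_sets_base)
    next
      case (Compl a)
      then show ?case by (simp add: Compl_eq_Diff_UNIV[symmetric])
    next
      case (Union a)
      have "(\<Union>i. a i \<times> space M) \<in> souslin_sets ?E"
        using Union.IH by (intro souslin_sets_UN[OF _ top]) blast
      moreover have "(\<Inter>i. (- a i) \<times> space M) \<in> souslin_sets ?E"
        using Union.IH by (intro souslin_sets_INT) blast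
      moreover have "(\<Union>i. a i \<times> space M) = (\<Union>i. a i) \<times> space M"
        "(\<Inter>i. (- a i) \<times> space M) = (- (\<Union>i. a i)) \<times> space M"
        by auto
      ultimately show ?case by simp
    qed
  qed
  have gen: "A \<in> souslin_sets ?E \<and> ?\<Omega> - A \<in> souslin_sets ?E"
    if AG: "A \<in> {a \<times> b | a b. a \<in> sets borel \<and> b \<in> sets M}" for A :: "('x \<times> 'w) set"
  proof -
    obtain a :: "'x set" and b where ab: "A = a \<times> b" "a \<in> sets borel" "b \<in> sets M"
      using AG by blast
    have b: "UNIV \<times> b \<in> souslin_sets ?E" "UNIV \<times> (space M - b) \<in> souslin_sets ?E"
      using ab(3) by (auto intro!: souslin_sets_base closed_rectanglesI)
    have "A = (a \<times> space M) \<inter> (UNIV \<times> b)" "?\<Omega> - A = ((- a) \<times> space M) \<union> (UNIV \<times> (space M - b))"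
      using sets.sets_into_space[OF ab(3)] unfolding ab(1) by auto
    moreover have "(a \<times> space M) \<inter> (UNIV \<times> b) \<in> souslin_sets ?E"
      using cyl[OF ab(2)] b(1) by (intro souslin_sets_Int) simp_all
    moreover have "((- a) \<times> space M) \<union> (UNIV \<times> (space M - b)) \<in> souslin_sets ?E"
      using cyl[OF ab(2)] b(2) by (intro souslin_sets_Un[OF _ _ top]) simp_all
    ultimately show ?thesis by simp
  qed
  have sub: "{a \<times> b | a b. a \<in> sets borel \<and> b \<in> sets M} \<subseteq> Pow ?\<Omega>"
    using sets.sets_into_space by auto
  have "B \<in> sigma_sets ?\<Omega> {a \<times> b | a b. a \<in> sets borel \<and> b \<in> sets M}"
    using assms by (simp add: sets_pair_measure)
  from sigma_sets_subset_souslin_sets[OF top gen sub e this] show ?thesis ..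
qed

text \<open>
  The scheme of \<open>B\<close> is refined by balls of radius \<open>2\<^sup>-\<^sup>n\<close> around a dense sequence, so that along a
  branch the closed sets shrink to a point by completeness. Membership in the projection then only
  depends on the second factors and on the nonemptiness of finite intersections of the first ones.
\<close>

theorem measurable_projection:
  fixes B :: "('x::{complete_space, second_countable_topology} \<times> 'w) set"
  assumes M: "finite_measure M" and B: "B \<in> sets (borel \<Otimes>\<^sub>M M)"
  shows "\<exists>E\<in>sets M. \<exists>K\<in>sets M. K \<subseteq> snd ` B \<and> snd ` B \<subseteq> E \<and> E - K \<in> null_sets M"
proof -
  obtain Q where Q: "\<And>s. Q s \<in> closed_rectangles M" "B = souslin Q"
    using product_sets_souslin[OF B] unfolding souslin_sets_def by blast
  have "\<forall>s. \<exists>FA. closed (fst FA) \<and> snd FA \<in> sets M \<and> Q s = fst FA \<times> snd FA"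
    using Q(1) by (fastforce simp: closed_rectangles_def)
  from choice[OF this] obtain FA where FA: "\<And>s. closed (fst (FA s))" "\<And>s. snd (FA s) \<in> sets M"
    "\<And>s. Q s = fst (FA s) \<times> snd (FA s)"
    by blast
  define F where "F s = fst (FA s)" for s
  define A where "A s = snd (FA s)" for s
  have F: "closed (F s)" and A: "A s \<in> sets M" and QFA: "Q s = F s \<times> A s" for s
    using FA by (simp_all add: F_def A_def)
  obtain D :: "'x set" where D: "countable D" "\<And>X. open X \<Longrightarrow> X \<noteq> {} \<Longrightarrow> \<exists>d\<in>D. d \<in> X"
    using countable_dense_exists by blast
  have "D \<noteq> {}" using D(2)[of UNIV] by auto
  define q where "q = from_nat_into D"
  have q: "\<exists>n. x \<in> cball (q n) r" if r: "r > 0" for x r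
  proof -
    obtain d where d: "d \<in> D" "d \<in> ball x r"
      using D(2)[of "ball x r"] r by (metis centre_in_ball empty_iff open_ball)
    obtain n where "q n = d"
      unfolding q_def using from_nat_into_surj[OF D(1) d(1)] by blast
    then have "x \<in> cball (q n) r" using d by (simp add: dist_commute)
    then show ?thesis by blast
  qed
  \<comment> \<open>Each entry codes a pair: the first component continues the scheme of
    \<open>B\<close>, the second is the index of a ball centre.\<close>
  define fs where "fs s = map (\<lambda>c. fst (prod_decode c)) s" for s
  define G where "G s = F (fs s) \<inter>
    (if s = [] then UNIV else cball (q (snd (prod_decode (last s)))) ((1/2) ^ length s))" for s
  have G: "closed (G s)" for s
    using F by (auto simp: G_def intro!: closed_Int)
  \<comment> \<open>The first coordinate is eliminated here: whether the finitely many closed sets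
    have a common point depends on \<open>s\<close> alone, so \<open>W s\<close> is either a
    measurable second factor or empty.\<close>
  define W where "W s = (if (\<Inter>m\<le>length s. G (take m s)) \<noteq> {} then A (fs s) else {})" for s
  have fs: "fs (seq_prefix w n) = seq_prefix (\<lambda>i. fst (prod_decode (w i))) n" for w n
    by (simp add: fs_def seq_prefix_def)
  have W: "\<omega> \<in> W (seq_prefix w n) \<longleftrightarrow> (\<Inter>m\<le>n. G (seq_prefix w m)) \<noteq> {} \<and>
      \<omega> \<in> A (seq_prefix (\<lambda>i. fst (prod_decode (w i))) n)" for \<omega> w n
    by (simp add: W_def fs min_absorb1)
  have "snd ` B = souslin W"
  proof (intro set_eqI iffI)
    fix \<omega> assume "\<omega> \<in> snd ` B"
    then obtain x where "(x, \<omega>) \<in> souslin Q" using Q(2) by auto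
    then obtain z where z: "\<And>n. x \<in> F (seq_prefix z n)" "\<And>n. \<omega> \<in> A (seq_prefix z n)"
      by (auto simp: souslin_def QFA)
    have "\<forall>n. \<exists>k. x \<in> cball (q k) ((1/2) ^ Suc n)"
      by (intro allI q) simp
    from choice[OF this] obtain y where y: "\<And>n. x \<in> cball (q (y n)) ((1/2) ^ Suc n)"
      by blast
    define w where "w n = prod_encode (z n, y n)" for n
    have fs_w: "fs (seq_prefix w n) = seq_prefix z n" for n
      by (simp add: fs w_def)
    have "x \<in> G (seq_prefix w n)" for n
      \<comment> \<open>The last entry of the prefix of length \<open>n\<close> has index
        \<open>n - 1\<close>, and its ball has radius \<open>(1/2) ^ n\<close>. The empty prefix
        imposes no ball.\<close>
      unfolding G_def fs_w using z(1)[of n] y[of "n - 1"] by (cases n) (simp_all add: w_def)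
    then have "(\<Inter>m\<le>n. G (seq_prefix w m)) \<noteq> {}" for n by blast
    then have "\<omega> \<in> W (seq_prefix w n)" for n
      using z(2)[of n] unfolding W by (simp add: w_def)
    then show "\<omega> \<in> souslin W" unfolding souslin_def by blast
  next
    fix \<omega> assume "\<omega> \<in> souslin W"
    then obtain w where w: "\<And>n. (\<Inter>m\<le>n. G (seq_prefix w m)) \<noteq> {}"
      "\<And>n. \<omega> \<in> A (seq_prefix (\<lambda>i. fst (prod_decode (w i))) n)"
      by (auto simp: souslin_def W)
    \<comment> \<open>Cantor's intersection theorem: finite intersections are nonempty by the
      definition of \<open>W\<close>, and the balls make the diameters tend to 0. This recovers a
      single \<open>x\<close> for the whole branch.\<close>
    have "\<Inter>(range (\<lambda>n. \<Inter>m\<le>n. G (seq_prefix w m))) \<noteq> {}"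
    proof (rule decreasing_closed_nest[of "\<lambda>n. \<Inter>m\<le>n. G (seq_prefix w m)"])
      show "\<And>n. closed (\<Inter>m\<le>n. G (seq_prefix w m))"
        using G by blast
      show "\<And>m n. m \<le> n \<Longrightarrow> (\<Inter>i\<le>n. G (seq_prefix w i)) \<subseteq> (\<Inter>i\<le>m. G (seq_prefix w i))"
        by (intro INF_superset_mono) auto
      fix e :: real assume e: "e > 0"
      obtain n where n: "(1/2 :: real) ^ n < e / 2"
        using real_arch_pow_inv[of "e / 2" "1/2"] e by auto
      have "dist x y < e" if xy: "x \<in> (\<Inter>m\<le>Suc n. G (seq_prefix w m))" "y \<in> (\<Inter>m\<le>Suc n. G (seq_prefix w m))" for x y
      proof -
        let ?c = "q (snd (prod_decode (w n)))"
        have "x \<in> G (seq_prefix w (Suc n))" "y \<in> G (seq_prefix w (Suc n))"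
          using xy by blast+
        then have "dist ?c x \<le> (1/2) ^ Suc n" "dist ?c y \<le> (1/2) ^ Suc n"
          by (simp_all add: G_def)
        then have "dist x y \<le> (1/2) ^ n"
          using dist_triangle3[of x y ?c] by simp
        also have "\<dots> < e" using n e by simp
        finally show ?thesis .
      qed
      then show "\<exists>n. \<forall>x\<in>(\<Inter>m\<le>n. G (seq_prefix w m)). \<forall>y\<in>(\<Inter>m\<le>n. G (seq_prefix w m)). dist x y < e"
        by blast
    qed (use w(1) in blast)+
    then obtain x where "\<And>n. x \<in> G (seq_prefix w n)" by blast
    then have "(x, \<omega>) \<in> Q (seq_prefix (\<lambda>i. fst (prod_decode (w i))) n)" for n
      using w(2) by (auto simp: QFA G_def fs)
    then have "(x, \<omega>) \<in> B" unfolding Q(2) souslin_def by blast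
    then show "\<omega> \<in> snd ` B" by force
  qed
  moreover have "W s \<in> sets M" for s
    using A by (simp add: W_def)
  ultimately show ?thesis
    using souslin_measurable_up_to_null[OF M, of W] by simp
qed

subsection \<open>Stability under a contraction in the mean\<close>

lemma log_integrable_min:
  assumes "log_integrable P f" "log_integrable P g"
  shows "log_integrable P (\<lambda>\<omega>. min (f \<omega>) (g \<omega>))"
proof -
  have pos: "\<And>\<omega>. \<omega> \<in> space P \<Longrightarrow> f \<omega> > 0" "\<And>\<omega>. \<omega> \<in> space P \<Longrightarrow> g \<omega> > 0"
    and [measurable]: "f \<in> borel_measurable P" "g \<in> borel_measurable P"
    and i: "integrable P (\<lambda>\<omega>. ln (f \<omega>))" "integrable P (\<lambda>\<omega>. ln (g \<omega>))"
    using assms by (auto simp: log_integrable_def pos_random_variable_def)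
  have "integrable P (\<lambda>\<omega>. min (ln (f \<omega>)) (ln (g \<omega>)))"
    using i by (rule Bochner_Integration.integrable_min)
  also have "?this \<longleftrightarrow> integrable P (\<lambda>\<omega>. ln (min (f \<omega>) (g \<omega>)))"
    using pos by (intro Bochner_Integration.integrable_cong refl) (auto simp: min_def)
  finally show ?thesis
    using pos by (auto simp: log_integrable_def pos_random_variable_def)
qed

section \<open>Arithmetic of the time set and iterates of the time-\<open>M\<close> map\<close>

context ergodic_semigroup
begin

lemma time_0: "0 \<in> TT"
  using time by auto

lemma time_mult: "M \<in> TT \<Longrightarrow> real n * M \<in> TT"
  using time by (auto simp: Nats_def simp flip: of_nat_mult)

lemma time_add: "s \<in> TT \<Longrightarrow> t \<in> TT \<Longrightarrow> s + t \<in> TT"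
  using time by auto

lemma time_diff: "s \<in> TT \<Longrightarrow> t \<in> TT \<Longrightarrow> s \<le> t \<Longrightarrow> t - s \<in> TT"
  using time by (auto simp: Nats_def simp flip: of_nat_diff)

lemma time_nonneg: "t \<in> TT \<Longrightarrow> 0 \<le> t"
  using time by (auto simp: Nats_def)

lemma time_decompose:
  assumes "t \<in> TT" "M \<in> TT" "M > 0"
  obtains n s where "s \<in> TT" "t = real n * M + s" "s \<le> M"
proof -
  define n where "n = nat \<lfloor>t / M\<rfloor>"
  have "t / M \<ge> 0" using assms time_nonneg by simp
  then have "real n \<le> t / M" "t / M \<le> real n + 1"
    unfolding n_def by linarith+
  then have le: "real n * M \<le> t" and "t - real n * M \<le> M"
    using assms(3) by (simp_all add: field_simps)
  moreover have "t - real n * M \<in> TT"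
    using time_diff[OF time_mult[OF assms(2)] assms(1) le] .
  ultimately show ?thesis
    using that[of "t - real n * M" n] by simp
qed

lemma T_space:
  assumes "t \<in> TT" "\<omega> \<in> space P"
  shows "T t \<omega> \<in> space P"
proof -
  have "T t \<in> P \<rightarrow>\<^sub>M P"
    using preserving[OF assms(1)] by (simp add: measure_preserving_map_def)
  then show ?thesis using assms(2) by (rule measurable_space)
qed

lemma T_mult:
  assumes "M \<in> TT" "\<omega> \<in> space P"
  shows "T (real n * M) \<omega> = (T M ^^ n) \<omega>"
proof (induction n)
  case 0
  then show ?case using assms by (simp add: semigroup_0)
next
  case (Suc n)
  have "T (real (Suc n) * M) \<omega> = T (M + real n * M) \<omega>" by (simp add: algebra_simps)
  also have "\<dots> = T M (T (real n * M) \<omega>)"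
    using assms time_mult by (intro semigroup_add) auto
  finally show ?case using Suc by simp
qed

end

text \<open>A decay by \<open>r\<close> per step of length \<open>M\<close> means rate
  \<open>r / M\<close>. Half of it is given up to absorb the additive constant for large
  \<open>t\<close>.\<close>

lemma Limsup_scaled_eln_le:
  assumes M: "M > 0" and r: "r < 0"
    and le: "\<And>t. t \<in> TT \<Longrightarrow> t > 0 \<Longrightarrow> \<exists>n::nat. t \<le> (real n + 1) * M \<and> u t \<le> exp (r * real n + c)"
    and u: "\<And>t. u t \<ge> 0"
  shows "Limsup (inf at_top (principal TT)) (\<lambda>t. ereal (1 / t) * eln (u t)) \<le> ereal (r / (2 * M))"
proof (rule Limsup_bounded)
  \<comment> \<open>Only \<open>n \<ge> t / M - 1\<close> is known, and the missing step costs
    \<open>- r\<close>.\<close>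
  let ?c = "c - r"
  have "\<forall>\<^sub>F t in at_top. t > max 0 (2 * M * ?c / - r)"
    by (rule eventually_gt_at_top)
  then have ev: "\<forall>\<^sub>F t in inf at_top (principal TT). t \<in> TT \<and> t > 0 \<and> t > 2 * M * ?c / - r"
    unfolding eventually_inf_principal by eventually_elim auto
  then show "\<forall>\<^sub>F t in inf at_top (principal TT). ereal (1 / t) * eln (u t) \<le> ereal (r / (2 * M))"
  proof eventually_elim
    case (elim t)
    then have t: "t > 0" and tc: "t > 2 * M * ?c / - r" by auto
    show ?case
    proof (cases "u t = 0")
      case True
      then show ?thesis using t by (simp add: eln_def)
    next
      case False
      obtain n :: nat where n: "t \<le> (real n + 1) * M" "u t \<le> exp (r * real n + c)"
        using le elim by blast
      have "ln (u t) \<le> r * real n + c"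
        using n(2) u[of t] False by (metis ln_exp ln_mono less_eq_real_def)
      also have "\<dots> \<le> r * (t / M - 1) + c"
      proof -
        have "t / M - 1 \<le> real n" using n(1) M by (simp add: field_simps)
        then show ?thesis using r by (simp add: mult_left_mono_neg)
      qed
      also have "\<dots> = r * t / M + ?c" by (simp add: algebra_simps)
      also have "\<dots> \<le> r * t / (2 * M)"
      proof -
        have "2 * M * ?c \<le> - (r * t)" using tc r by (simp add: field_simps)
        then have "?c \<le> - (r * t) / (2 * M)"
          using M by (subst pos_le_divide_eq) (simp_all add: algebra_simps)
        moreover have "r * t / M = 2 * (r * t / (2 * M))" "- (r * t) / (2 * M) = - (r * t / (2 * M))"
          by simp_all
        ultimately show ?thesis by linarith
      qed
      finally have "1 / t * ln (u t) \<le> 1 / t * (r * t / (2 * M))"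
        using t by (intro mult_left_mono) auto
      also have "\<dots> = r / (2 * M)" using t by simp
      finally show ?thesis using False by (simp add: eln_def)
    qed
  qed
qed

text \<open>
  The radius \<open>\<gamma>\<close> is chosen so small that the orbit of the time-\<open>M\<close> map never leaves the balls on
  which the Lipschitz and Hoelder bounds hold.
\<close>

theorem (in cocycle_with_equilibrium) stable_if_contracting:
  assumes M: "M \<in> TT" "M > 0"
    and lip: "lipschitz_at_equilibrium P (C M) (xbar 0) XX L \<delta>"
    and neg: "(\<integral>\<omega>. ln (L \<omega>) \<partial>P) < 0"
    and hoe: "hoelder_up_to P TT C (xbar 0) XX M"
  shows "locally_exponentially_stable P TT C xbar XX"
proof -
  obtain H \<kappa> b where H: "log_integrable P H" and \<kappa>: "log_integrable P \<kappa>" and b: "b > 0"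
    and hoelder: "AE \<omega> in P. \<forall>x\<in>local_ball XX (xbar 0) \<omega> (\<kappa> \<omega>). \<forall>t\<in>TT. 0 \<le> t \<and> t \<le> M \<longrightarrow>
           dist (C t x \<omega>) (C t (xbar 0 \<omega>) \<omega>) \<le> H \<omega> * dist x (xbar 0 \<omega>) powr b"
    using hoe unfolding hoelder_up_to_def by blast
  have L: "log_integrable P L" and \<delta>: "log_integrable P \<delta>"
    and lipschitz: "\<And>\<omega> x. \<omega> \<in> space P \<Longrightarrow> x \<in> local_ball XX (xbar 0) \<omega> (\<delta> \<omega>) \<Longrightarrow>
        dist (C M x \<omega>) (C M (xbar 0 \<omega>) \<omega>) \<le> L \<omega> * dist x (xbar 0 \<omega>)"
    using lip unfolding lipschitz_at_equilibrium_def by blast+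
  define \<rho> where "\<rho> \<omega> = min (\<delta> \<omega>) (\<kappa> \<omega>)" for \<omega>
  have \<rho>: "log_integrable P \<rho>"
    using log_integrable_min[OF \<delta> \<kappa>] unfolding \<rho>_def .
  have Lpos: "\<And>\<omega>. \<omega> \<in> space P \<Longrightarrow> L \<omega> > 0" and Lm [measurable]: "L \<in> borel_measurable P"
    and Li: "integrable P (\<lambda>\<omega>. ln (L \<omega>))"
    using L by (auto simp: log_integrable_def pos_random_variable_def)
  have Hpos: "\<And>\<omega>. \<omega> \<in> space P \<Longrightarrow> H \<omega> > 0" and Hi: "integrable P (\<lambda>\<omega>. ln (H \<omega>))"
    using H by (auto simp: log_integrable_def pos_random_variable_def)
  have \<rho>pos: "\<And>\<omega>. \<omega> \<in> space P \<Longrightarrow> \<rho> \<omega> > 0" and \<rho>m [measurable]: "\<rho> \<in> borel_measurable P"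
    and \<rho>i: "integrable P (\<lambda>\<omega>. ln (\<rho> \<omega>))"
    using \<rho> by (auto simp: log_integrable_def pos_random_variable_def)
  have P: "prob_space P" by (rule prob_space_axioms)
  have S: "measure_preserving_map P (T M)" and erg: "ergodic_map P (T M)"
    using M preserving ergodic by auto
  define \<theta> where "\<theta> n \<omega> = (T M ^^ n) \<omega>" for n \<omega>
  have \<theta>T: "\<theta> n \<omega> = T (real n * M) \<omega>" if "\<omega> \<in> space P" for n \<omega>
    using T_mult[OF M(1) that] by (simp add: \<theta>_def)
  have \<theta>_space: "\<theta> n \<omega> \<in> space P" if "\<omega> \<in> space P" for n \<omega>
    using \<theta>T[OF that] T_space[OF time_mult[OF M(1)] that] by simp
  have "T M \<in> P \<rightarrow>\<^sub>M P" using S by (simp add: measure_preserving_map_def)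
  then have \<theta>m [measurable]: "\<theta> n \<in> P \<rightarrow>\<^sub>M P" for n
    unfolding \<theta>_def by (rule measurable_compose_n)
  define I where "I = (\<integral>\<omega>. ln (L \<omega>) \<partial>P)"
  define \<sigma> where "\<sigma> n \<omega> = (\<Sum>i<n. ln (L (\<theta> i \<omega>)))" for n \<omega>
  have \<sigma>m [measurable]: "\<sigma> n \<in> borel_measurable P" for n
    unfolding \<sigma>_def by measurable
  \<comment> \<open>After \<open>n\<close> steps distances have been multiplied by at most
    \<open>exp (\<sigma> n \<omega>)\<close>. An initial distance not above this infimum therefore
    stays within \<rho> at every step.\<close>
  define \<Gamma> where "\<Gamma> \<omega> = (INF n. \<rho> (\<theta> n \<omega>) * exp (- \<sigma> n \<omega>))" for \<omega>
  have \<Gamma>m [measurable]: "\<Gamma> \<in> borel_measurable P"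
    unfolding \<Gamma>_def by measurable
  \<comment> \<open>\<Gamma> is shown to be positive only almost surely, whereas a positive random
    variable is positive on all of \<open>space P\<close>; 1 is a placeholder.\<close>
  define \<gamma> where "\<gamma> \<omega> = (if 0 < \<Gamma> \<omega> then \<Gamma> \<omega> else 1)" for \<omega>
  have "pos_random_variable P \<gamma>"
    unfolding pos_random_variable_def \<gamma>_def by auto
  \<comment> \<open>Per step, the Lipschitz factors contribute \<open>I / 2\<close>, hence
    \<open>b * I / 2\<close> after the Hoelder bound, and the growth of \<open>H\<close> costs at
    most \<open>- b * I / 4\<close>. The remaining \<open>b * I / 4\<close> is divided by
    \<open>2 * M\<close> in \<open>Limsup_scaled_eln_le\<close>.\<close>
  moreover have "b * I / (8 * M) < 0"
    using b M neg by (simp add: I_def divide_neg_pos mult_pos_neg)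
  moreover have "AE \<omega> in P. \<forall>a\<in>local_ball XX (xbar 0) \<omega> (\<gamma> \<omega>).
      Limsup (inf at_top (principal TT)) (\<lambda>t. ereal (1 / t) * eln (dist (C t a \<omega>) (xbar t \<omega>)))
        \<le> ereal (b * I / (8 * M))"
  proof -
    have "AE \<omega> in P. \<exists>K. \<forall>n. \<sigma> n \<omega> \<le> I / 2 * real n + K"
      unfolding \<sigma>_def \<theta>_def using neg
      by (intro birkhoff_sums_linear_bound[OF P S erg Li]) (simp add: I_def)
    \<comment> \<open>The slope \<open>- I / 2\<close> exactly offsets the slope of \<sigma>, so
      that \<open>\<rho> (\<theta> n \<omega>) * exp (- \<sigma> n \<omega>)\<close> stays above a
      positive constant.\<close>
    moreover have "AE \<omega> in P. \<exists>K. \<forall>n. \<bar>ln (\<rho> (\<theta> n \<omega>))\<bar> \<le> - I / 2 * real n + K"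
      unfolding \<theta>_def using neg
      by (intro orbit_sublinear_growth[OF P S erg \<rho>i]) (simp add: I_def)
    moreover have "AE \<omega> in P. \<exists>K. \<forall>n. \<bar>ln (H (\<theta> n \<omega>))\<bar> \<le> - (b * I) / 4 * real n + K"
      unfolding \<theta>_def using neg b
      by (intro orbit_sublinear_growth[OF P S erg Hi]) (simp add: I_def mult_pos_neg)
    moreover have "AE \<omega> in P. \<forall>n. \<forall>x\<in>local_ball XX (xbar 0) (\<theta> n \<omega>) (\<kappa> (\<theta> n \<omega>)). \<forall>t\<in>TT. 0 \<le> t \<and> t \<le> M \<longrightarrow>
           dist (C t x (\<theta> n \<omega>)) (C t (xbar 0 (\<theta> n \<omega>)) (\<theta> n \<omega>)) \<le> H (\<theta> n \<omega>) * dist x (xbar 0 (\<theta> n \<omega>)) powr b"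
      unfolding AE_all_countable
    proof
      fix n
      have "AE \<omega> in P. \<forall>x\<in>local_ball XX (xbar 0) (T (real n * M) \<omega>) (\<kappa> (T (real n * M) \<omega>)). \<forall>t\<in>TT. 0 \<le> t \<and> t \<le> M \<longrightarrow>
           dist (C t x (T (real n * M) \<omega>)) (C t (xbar 0 (T (real n * M) \<omega>)) (T (real n * M) \<omega>))
             \<le> H (T (real n * M) \<omega>) * dist x (xbar 0 (T (real n * M) \<omega>)) powr b"
        using measure_preserving_map_AE[OF preserving[OF time_mult[OF M(1)]] hoelder] .
      with AE_space show "AE \<omega> in P. \<forall>x\<in>local_ball XX (xbar 0) (\<theta> n \<omega>) (\<kappa> (\<theta> n \<omega>)). \<forall>t\<in>TT. 0 \<le> t \<and> t \<le> M \<longrightarrow>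
           dist (C t x (\<theta> n \<omega>)) (C t (xbar 0 (\<theta> n \<omega>)) (\<theta> n \<omega>)) \<le> H (\<theta> n \<omega>) * dist x (xbar 0 (\<theta> n \<omega>)) powr b"
        by eventually_elim (simp only: \<theta>T)
    qed
    ultimately show ?thesis
      using equilibrium AE_space
    proof eventually_elim
      case (elim \<omega>)
      have \<omega>: "\<omega> \<in> space P" by fact
      obtain K1 where K1: "\<And>n. \<sigma> n \<omega> \<le> I / 2 * real n + K1" using elim(1) by blast
      obtain K2 where K2: "\<And>n. \<bar>ln (\<rho> (\<theta> n \<omega>))\<bar> \<le> - I / 2 * real n + K2" using elim(2) by blast
      obtain K3 where K3: "\<And>n. \<bar>ln (H (\<theta> n \<omega>))\<bar> \<le> - (b * I) / 4 * real n + K3" using elim(3) by blast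
      note hoe\<omega> = elim(4)[rule_format]
      have eq: "C t (xbar 0 \<omega>) \<omega> = xbar 0 (T t \<omega>)" "xbar t \<omega> = xbar 0 (T t \<omega>)" if "t \<in> TT" for t
        using elim(5) that by metis+
      have low: "exp (- K1 - K2) \<le> \<rho> (\<theta> n \<omega>) * exp (- \<sigma> n \<omega>)" for n
      proof -
        have "- K1 - K2 \<le> ln (\<rho> (\<theta> n \<omega>)) - \<sigma> n \<omega>"
          using K1[of n] K2[of n] by linarith
        then have "exp (- K1 - K2) \<le> exp (ln (\<rho> (\<theta> n \<omega>)) - \<sigma> n \<omega>)" by simp
        also have "\<dots> = \<rho> (\<theta> n \<omega>) * exp (- \<sigma> n \<omega>)"
          using \<rho>pos[OF \<theta>_space[OF \<omega>]] by (simp add: exp_diff exp_minus divide_inverse)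
        finally show ?thesis .
      qed
      have "exp (- K1 - K2) \<le> \<Gamma> \<omega>"
        unfolding \<Gamma>_def using low by (intro cINF_greatest) auto
      then have "0 < \<Gamma> \<omega>" by (rule less_le_trans[OF exp_gt_zero])
      then have \<gamma>: "\<gamma> \<omega> = \<Gamma> \<omega>" "\<gamma> \<omega> > 0" by (simp_all add: \<gamma>_def)
      have \<gamma>le: "\<gamma> \<omega> \<le> \<rho> (\<theta> n \<omega>) * exp (- \<sigma> n \<omega>)" for n
        unfolding \<gamma> \<Gamma>_def using low by (intro cINF_lower bdd_belowI2) auto
      show ?case
      proof
        fix a assume "a \<in> local_ball XX (xbar 0) \<omega> (\<gamma> \<omega>)"
        then have a: "a \<in> XX \<omega>" "dist a (xbar 0 \<omega>) \<le> \<gamma> \<omega>" by (auto simp: local_ball_def)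
        define x where "x n = C (real n * M) a \<omega>" for n
        have x_in: "x n \<in> XX (\<theta> n \<omega>)" for n
          unfolding x_def \<theta>T[OF \<omega>] using invariant[OF time_mult[OF M(1)] \<omega> a(1)] .
        have step: "C (real n * M + s) a \<omega> = C s (x n) (\<theta> n \<omega>)"
          "C s (xbar 0 (\<theta> n \<omega>)) (\<theta> n \<omega>) = xbar (real n * M + s) \<omega>" if "s \<in> TT" for n s
        proof -
          have n: "real n * M \<in> TT" by (rule time_mult[OF M(1)])
          show "C (real n * M + s) a \<omega> = C s (x n) (\<theta> n \<omega>)"
            unfolding x_def \<theta>T[OF \<omega>] using C_add[OF n that \<omega>] .
          have "C s (xbar 0 (\<theta> n \<omega>)) (\<theta> n \<omega>) = C (real n * M + s) (xbar 0 \<omega>) \<omega>"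
            using C_add[OF n that \<omega>] eq(1)[OF n] \<theta>T[OF \<omega>] by simp
          then show "C s (xbar 0 (\<theta> n \<omega>)) (\<theta> n \<omega>) = xbar (real n * M + s) \<omega>"
            using eq[OF time_add[OF n that]] by simp
        qed
        \<comment> \<open>The bound at \<open>n\<close> puts \<open>x n\<close> into the
          \<delta>-ball by the choice of \<gamma>, and this licenses the Lipschitz estimate that
          gives the bound at \<open>n + 1\<close>.\<close>
        have dist_x: "dist (x n) (xbar 0 (\<theta> n \<omega>)) \<le> exp (\<sigma> n \<omega>) * \<gamma> \<omega>" for n
        proof (induction n)
          case 0
          then show ?case using a(2) C_0[OF \<omega>] by (simp add: x_def \<theta>_def \<sigma>_def)
        next
          case (Suc n)
          have "exp (\<sigma> n \<omega>) * \<gamma> \<omega> \<le> exp (\<sigma> n \<omega>) * (\<rho> (\<theta> n \<omega>) * exp (- \<sigma> n \<omega>))"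
            using \<gamma>le by (intro mult_left_mono) auto
          also have "\<dots> = \<rho> (\<theta> n \<omega>)" by (simp add: exp_minus)
          finally have "x n \<in> local_ball XX (xbar 0) (\<theta> n \<omega>) (\<delta> (\<theta> n \<omega>))"
            using x_in Suc by (auto simp: local_ball_def \<rho>_def)
          from lipschitz[OF \<theta>_space[OF \<omega>] this]
          have "dist (C M (x n) (\<theta> n \<omega>)) (C M (xbar 0 (\<theta> n \<omega>)) (\<theta> n \<omega>))
              \<le> L (\<theta> n \<omega>) * dist (x n) (xbar 0 (\<theta> n \<omega>))" .
          also have "\<dots> \<le> L (\<theta> n \<omega>) * (exp (\<sigma> n \<omega>) * \<gamma> \<omega>)"
            using Suc Lpos[OF \<theta>_space[OF \<omega>]] by (intro mult_left_mono) (auto intro: less_imp_le)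
          also have "\<dots> = exp (\<sigma> (Suc n) \<omega>) * \<gamma> \<omega>"
            using Lpos[OF \<theta>_space[OF \<omega>]] by (simp add: \<sigma>_def exp_add)
          also have "C M (x n) (\<theta> n \<omega>) = x (Suc n)"
            using step(1)[OF M(1), of n] by (simp add: x_def algebra_simps)
          also have "C M (xbar 0 (\<theta> n \<omega>)) (\<theta> n \<omega>) = xbar 0 (\<theta> (Suc n) \<omega>)"
            using step(2)[OF M(1), of n] eq(2)[OF time_mult[OF M(1)], of "Suc n"] \<theta>T[OF \<omega>, of "Suc n"]
            by (simp add: algebra_simps)
          finally show ?case .
        qed
        have x_ball: "x n \<in> local_ball XX (xbar 0) (\<theta> n \<omega>) (\<kappa> (\<theta> n \<omega>))" for n
        proof -
          have "exp (\<sigma> n \<omega>) * \<gamma> \<omega> \<le> exp (\<sigma> n \<omega>) * (\<rho> (\<theta> n \<omega>) * exp (- \<sigma> n \<omega>))"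
            using \<gamma>le by (intro mult_left_mono) auto
          also have "\<dots> = \<rho> (\<theta> n \<omega>)" by (simp add: exp_minus)
          finally show ?thesis
            using x_in dist_x[of n] by (auto simp: local_ball_def \<rho>_def)
        qed
        define c where "c = K3 + b * (K1 + ln (\<gamma> \<omega>))"
        have bound: "dist (C (real n * M + s) a \<omega>) (xbar (real n * M + s) \<omega>) \<le> exp (b * I / 4 * real n + c)"
          if s: "s \<in> TT" "s \<le> M" for n s
        proof -
          have "dist (C (real n * M + s) a \<omega>) (xbar (real n * M + s) \<omega>)
              \<le> H (\<theta> n \<omega>) * dist (x n) (xbar 0 (\<theta> n \<omega>)) powr b"
            using hoe\<omega>[OF x_ball[of n] s(1)] s time_nonneg[OF s(1)] step[OF s(1), of n] by simp
          also have "\<dots> \<le> exp (- (b * I) / 4 * real n + K3) * exp (b * (I / 2 * real n + K1 + ln (\<gamma> \<omega>)))"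
          proof (intro mult_mono)
            have "ln (H (\<theta> n \<omega>)) \<le> - (b * I) / 4 * real n + K3" using K3[of n] by linarith
            then show "H (\<theta> n \<omega>) \<le> exp (- (b * I) / 4 * real n + K3)"
              using Hpos[OF \<theta>_space[OF \<omega>, of n]] by (metis exp_le_cancel_iff exp_ln)
            have "dist (x n) (xbar 0 (\<theta> n \<omega>)) \<le> exp (I / 2 * real n + K1) * \<gamma> \<omega>"
              using \<gamma>(2) K1[of n] by (intro order_trans[OF dist_x] mult_right_mono) auto
            also have "\<dots> = exp (I / 2 * real n + K1 + ln (\<gamma> \<omega>))"
              using \<gamma>(2) by (simp add: exp_add)
            finally have "dist (x n) (xbar 0 (\<theta> n \<omega>)) powr b \<le> exp (I / 2 * real n + K1 + ln (\<gamma> \<omega>)) powr b"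
              using b by (intro powr_mono2) auto
            then show "dist (x n) (xbar 0 (\<theta> n \<omega>)) powr b \<le> exp (b * (I / 2 * real n + K1 + ln (\<gamma> \<omega>)))"
              by (simp add: powr_def)
          qed auto
          also have "\<dots> = exp (b * I / 4 * real n + c)"
            unfolding exp_add[symmetric] c_def by (simp add: algebra_simps)
          finally show ?thesis .
        qed
        have "Limsup (inf at_top (principal TT)) (\<lambda>t. ereal (1 / t) * eln (dist (C t a \<omega>) (xbar t \<omega>)))
            \<le> ereal ((b * I / 4) / (2 * M))"
        proof (rule Limsup_scaled_eln_le)
          show "M > 0" by (rule M)
          show "b * I / 4 < 0" using b neg by (simp add: I_def mult_pos_neg)
          fix t assume "t \<in> TT" "t > 0"
          obtain n s where s: "s \<in> TT" "t = real n * M + s" "s \<le> M"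
            using time_decompose[OF \<open>t \<in> TT\<close> M] .
          have "t \<le> (real n + 1) * M" using s by (simp add: algebra_simps)
          then show "\<exists>n::nat. t \<le> (real n + 1) * M \<and> dist (C t a \<omega>) (xbar t \<omega>) \<le> exp (b * I / 4 * real n + c)"
            using bound[OF s(1,3), of n] unfolding s(2) by blast
        qed simp
        also have "(b * I / 4) / (2 * M) = b * I / (8 * M)" by simp
        finally show "Limsup (inf at_top (principal TT)) (\<lambda>t. ereal (1 / t) * eln (dist (C t a \<omega>) (xbar t \<omega>)))
            \<le> ereal (b * I / (8 * M))" .
      qed
    qed
  qed
  ultimately show ?thesis
    unfolding locally_exponentially_stable_def by blast
qed

subsection \<open>Contraction from the derivative\<close>

text \<open>Measurability of the derivative in \<omega> is obtained from this representation by
  limits of explicit expressions in \<open>f\<close>.\<close>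

lemma has_derivative_imp_difference_quotients:
  fixes f :: "'a::real_normed_vector \<Rightarrow> 'b::real_normed_vector"
  assumes "(f has_derivative F) (at x)"
  shows "(\<lambda>n. real (Suc n) *\<^sub>R (f (x + (1 / real (Suc n)) *\<^sub>R h) - f x)) \<longlonglongrightarrow> F h"
proof (rule LIMSEQ_I)
  fix r :: real assume r: "r > 0"
  have F: "bounded_linear F" using assms by (rule has_derivative_bounded_linear)
  define e where "e = r / 2 / (norm h + 1)"
  have h1: "norm h + 1 > 0" by (simp add: add_nonneg_pos)
  have e: "e > 0" using r h1 by (simp add: e_def)
  obtain d where d: "d > 0"
    "\<And>y. norm (y - x) < d \<Longrightarrow> norm (f y - f x - F (y - x)) \<le> e * norm (y - x)"
    using assms e unfolding has_derivative_at_alt by blast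
  obtain N :: nat where N: "(norm h + 1) / d < real N"
    using reals_Archimedean2 by blast
  have "norm (real (Suc n) *\<^sub>R (f (x + (1 / real (Suc n)) *\<^sub>R h) - f x) - F h) < r" if n: "n \<ge> N" for n
  proof -
    let ?s = "real (Suc n)"
    have s: "?s > 0" by simp
    have "norm h + 1 < d * ?s"
    proof -
      have "(norm h + 1) / d < ?s" using N n by linarith
      then show ?thesis using d(1) by (simp add: field_simps)
    qed
    then have "norm ((1 / ?s) *\<^sub>R h) < d" using s by (simp add: field_simps)
    then have "norm (f (x + (1 / ?s) *\<^sub>R h) - f x - F ((1 / ?s) *\<^sub>R h)) \<le> e * norm ((1 / ?s) *\<^sub>R h)"
      using d(2)[of "x + (1 / ?s) *\<^sub>R h"] by simp
    then have "?s * norm (f (x + (1 / ?s) *\<^sub>R h) - f x - F ((1 / ?s) *\<^sub>R h)) \<le> ?s * (e * norm ((1 / ?s) *\<^sub>R h))"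
      using s by (intro mult_left_mono) auto
    also have "\<dots> = e * norm h" using s by simp
    also have "?s * norm (f (x + (1 / ?s) *\<^sub>R h) - f x - F ((1 / ?s) *\<^sub>R h)) =
        norm (?s *\<^sub>R (f (x + (1 / ?s) *\<^sub>R h) - f x - F ((1 / ?s) *\<^sub>R h)))"
      by simp
    also have "?s *\<^sub>R (f (x + (1 / ?s) *\<^sub>R h) - f x - F ((1 / ?s) *\<^sub>R h)) =
        ?s *\<^sub>R (f (x + (1 / ?s) *\<^sub>R h) - f x) - F h"
      using s linear_scale[OF bounded_linear.linear[OF F], of "1 / ?s" h]
      by (simp add: scaleR_diff_right)
    finally have "norm (?s *\<^sub>R (f (x + (1 / ?s) *\<^sub>R h) - f x) - F h) \<le> e * norm h" .
    also have "\<dots> \<le> e * (norm h + 1)" using e by simp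
    also have "\<dots> = r / 2" using less_imp_neq[OF h1, symmetric] unfolding e_def by (metis nonzero_eq_divide_eq)
    also have "\<dots> < r" using r by simp
    finally show ?thesis .
  qed
  then show "\<exists>N. \<forall>n\<ge>N. norm (real (Suc n) *\<^sub>R (f (x + (1 / real (Suc n)) *\<^sub>R h) - f x) - F h) < r"
    by blast
qed

text \<open>The vectors violating the bound form an open set, which is empty once it misses a dense
  set. With countable \<open>D\<close>, sublevel sets of a random operator norm become countable
  intersections.\<close>

lemma onorm_le_iff_dense:
  fixes F :: "'a::real_normed_vector \<Rightarrow> 'b::real_normed_vector"
  assumes F: "bounded_linear F" and c: "0 \<le> c"
    and D: "\<And>X. open X \<Longrightarrow> X \<noteq> {} \<Longrightarrow> \<exists>d\<in>D. d \<in> X"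
  shows "onorm F \<le> c \<longleftrightarrow> (\<forall>h\<in>D. norm (F h) \<le> c * norm h)"
proof
  assume le: "onorm F \<le> c"
  show "\<forall>h\<in>D. norm (F h) \<le> c * norm h"
  proof
    fix h
    have "norm (F h) \<le> onorm F * norm h" by (rule onorm[OF F])
    also have "\<dots> \<le> c * norm h" using le by (intro mult_right_mono) auto
    finally show "norm (F h) \<le> c * norm h" .
  qed
next
  assume le: "\<forall>h\<in>D. norm (F h) \<le> c * norm h"
  have "continuous_on UNIV F" using F by (intro linear_continuous_on)
  then have "open {h. c * norm h < norm (F h)}"
    by (intro open_Collect_less continuous_intros)
  then have "{h. c * norm h < norm (F h)} = {}"
    using D[of "{h. c * norm h < norm (F h)}"] le by fastforce
  then show "onorm F \<le> c"
    using c by (intro onorm_bound) (auto simp: not_less)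
qed

lemma borel_measurable_onorm_derivative:
  fixes f :: "'b::{banach, second_countable_topology} \<Rightarrow> 'w \<Rightarrow> 'b"
  assumes f: "(\<lambda>(x, \<omega>). f x \<omega>) \<in> borel \<Otimes>\<^sub>M P \<rightarrow>\<^sub>M borel" and x0: "x0 \<in> P \<rightarrow>\<^sub>M borel"
    and F: "\<And>\<omega>. \<omega> \<in> space P \<Longrightarrow> ((\<lambda>x. f x \<omega>) has_derivative F \<omega>) (at (x0 \<omega>))"
  shows "(\<lambda>\<omega>. onorm (F \<omega>)) \<in> borel_measurable P"
proof -
  note [measurable] = x0
  have fm [measurable]: "(\<lambda>\<omega>. f (g \<omega>) \<omega>) \<in> P \<rightarrow>\<^sub>M borel" if [measurable]: "g \<in> P \<rightarrow>\<^sub>M borel" for g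
  proof -
    have "(\<lambda>\<omega>. (g \<omega>, \<omega>)) \<in> P \<rightarrow>\<^sub>M borel \<Otimes>\<^sub>M P" by measurable
    from measurable_compose[OF this f] show ?thesis by simp
  qed
  have Fm [measurable]: "(\<lambda>\<omega>. F \<omega> h) \<in> P \<rightarrow>\<^sub>M borel" for h
  proof (rule borel_measurable_LIMSEQ_metric)
    fix n
    show "(\<lambda>\<omega>. real (Suc n) *\<^sub>R (f (x0 \<omega> + (1 / real (Suc n)) *\<^sub>R h) \<omega> - f (x0 \<omega>) \<omega>)) \<in> P \<rightarrow>\<^sub>M borel"
      by measurable
  next
    fix \<omega> assume "\<omega> \<in> space P"
    then show "(\<lambda>n. real (Suc n) *\<^sub>R (f (x0 \<omega> + (1 / real (Suc n)) *\<^sub>R h) \<omega> - f (x0 \<omega>) \<omega>)) \<longlonglongrightarrow> F \<omega> h"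
      using has_derivative_imp_difference_quotients[OF F] by simp
  qed
  obtain D :: "'b set" where D: "countable D" "\<And>X. open X \<Longrightarrow> X \<noteq> {} \<Longrightarrow> \<exists>d\<in>D. d \<in> X"
    using countable_dense_exists by blast
  show ?thesis
    unfolding borel_measurable_iff_le
  proof
    fix c :: real
    have bl: "bounded_linear (F \<omega>)" if "\<omega> \<in> space P" for \<omega>
      using F[OF that] by (rule has_derivative_bounded_linear)
    show "{\<omega> \<in> space P. onorm (F \<omega>) \<le> c} \<in> sets P"
    proof (cases "0 \<le> c")
      case True
      have "{\<omega> \<in> space P. onorm (F \<omega>) \<le> c} = {\<omega> \<in> space P. \<forall>h\<in>D. norm (F \<omega> h) \<le> c * norm h}"
        using onorm_le_iff_dense[OF bl True D(2)] by blast
      also have "\<dots> \<in> sets P"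
        by (rule sets.sets_Collect_countable_All'[OF _ D(1)]) measurable
      finally show ?thesis .
    next
      case False
      then have "{\<omega> \<in> space P. onorm (F \<omega>) \<le> c} = {}"
        using onorm_pos_le[OF bl] by force
      then show ?thesis by (simp only: sets.empty_sets)
    qed
  qed
qed

text \<open>From \<open>g + e \<le> max 1 g * (1 + e)\<close> and \<open>ln (1 + e) \<le> e\<close>.
  The conditional on the right is the positive part of \<open>eln g\<close>, so the error vanishes
  with \<open>e\<close>.\<close>

lemma ln_add_le_pos_part:
  fixes g e :: real
  assumes "0 \<le> g" "0 < e"
  shows "ln (g + e) \<le> (if g = 0 then 0 else max 0 (ln g)) + e"
proof -
  have "g + e \<le> max 1 g * (1 + e)"
    using assms by (auto simp: max_def algebra_simps mult_le_cancel_left1)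
  then have "ln (g + e) \<le> ln (max 1 g * (1 + e))"
    using assms by (intro ln_mono) auto
  also have "\<dots> = ln (max 1 g) + ln (1 + e)"
    using assms by (intro ln_mult_pos) auto
  also have "\<dots> \<le> ln (max 1 g) + e"
    using assms by (simp add: ln_add_one_self_le_self)
  also have "ln (max 1 g) = (if g = 0 then 0 else max 0 (ln g))"
    using assms by (auto simp: max_def)
  finally show ?thesis .
qed

lemma e2ennreal_eln: "e2ennreal (eln g) = ennreal (if g = 0 then 0 else max 0 (ln g))"
  by (auto simp: eln_def max_def ennreal_neg ereal_0_gt_inverse e2ennreal_neg)

text \<open>Shifting by \<open>e\<close> removes the value \<open>-\<infinity>\<close>. As
  \<open>e\<close> decreases to 0, the negative parts of \<open>ln (g + e)\<close> increase to that
  of \<open>eln g\<close> and converge in mean by monotone convergence, while the means of the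
  positive parts exceed \<open>p\<close> by at most \<open>e\<close>.\<close>

lemma expectation_ln_add_neg:
  fixes g :: "'w \<Rightarrow> real"
  assumes P: "prob_space P" and g [measurable]: "g \<in> borel_measurable P"
    and g0: "\<And>\<omega>. 0 \<le> g \<omega>" and neg: "ereal_expectation P (\<lambda>\<omega>. eln (g \<omega>)) < 0"
  shows "\<exists>e>0. integrable P (\<lambda>\<omega>. ln (g \<omega> + e)) \<and> (\<integral>\<omega>. ln (g \<omega> + e) \<partial>P) < 0"
proof -
  interpret prob_space P by (rule P)
  define p where "p = (\<integral>\<^sup>+ \<omega>. e2ennreal (eln (g \<omega>)) \<partial>P)"
  define q where "q = (\<integral>\<^sup>+ \<omega>. e2ennreal (- eln (g \<omega>)) \<partial>P)"
  have pq0: "enn2ereal p - enn2ereal q < 0"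
    using neg by (simp add: ereal_expectation_def p_def q_def)
  then have "enn2ereal p < enn2ereal q"
    by (cases "enn2ereal p"; cases "enn2ereal q") auto
  then have pq: "p < q" by (simp add: less_ennreal.rep_eq)
  define e where "e k = 1 / real (Suc k)" for k
  have e: "e k > 0" for k by (simp add: e_def)
  have e_lim: "e \<longlonglongrightarrow> 0"
    unfolding e_def using LIMSEQ_inverse_real_of_nat by (simp add: inverse_eq_divide)
  have e_dec: "e (Suc k) \<le> e k" for k by (simp add: e_def field_simps)
  define N where "N k = (\<integral>\<^sup>+ \<omega>. ennreal (- ln (g \<omega> + e k)) \<partial>P)" for k
  have "N \<longlonglongrightarrow> q"
    unfolding N_def q_def
  proof (rule nn_integral_LIMSEQ)
    show "incseq (\<lambda>k \<omega>. ennreal (- ln (g \<omega> + e k)))"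
    proof (intro incseq_SucI le_funI ennreal_leI)
      fix k \<omega>
      have "ln (g \<omega> + e (Suc k)) \<le> ln (g \<omega> + e k)"
        using g0[of \<omega>] e[of "Suc k"] e_dec[of k] by (intro ln_mono) auto
      then show "- ln (g \<omega> + e k) \<le> - ln (g \<omega> + e (Suc k))" by simp
    qed
    fix \<omega>
    show "(\<lambda>k. ennreal (- ln (g \<omega> + e k))) \<longlonglongrightarrow> e2ennreal (- eln (g \<omega>))"
    proof (cases "g \<omega> = 0")
      case True
      have "filterlim e (at_right 0) sequentially"
        using e_lim e less_imp_neq[OF e, symmetric] by (simp add: filterlim_at)
      then have "filterlim (\<lambda>k. ln (e k)) at_bot sequentially"
        by (rule filterlim_compose[OF ln_at_0])
      then have "filterlim (\<lambda>k. - ln (e k)) at_top sequentially"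
        by (simp add: filterlim_uminus_at_top)
      then have "(\<lambda>k. ennreal (- ln (e k))) \<longlonglongrightarrow> top"
        by (simp only: ennreal_tendsto_top_eq_at_top)
      then show ?thesis using True by (simp add: eln_def)
    next
      case False
      have "(\<lambda>k. - ln (g \<omega> + e k)) \<longlonglongrightarrow> - ln (g \<omega> + 0)"
        using False by (intro tendsto_intros e_lim) auto
      then have "(\<lambda>k. ennreal (- ln (g \<omega> + e k))) \<longlonglongrightarrow> ennreal (- ln (g \<omega>))"
        by (intro tendsto_ennrealI) simp
      then show ?thesis using False by (simp add: eln_def)
    qed
  qed measurable
  \<comment> \<open>An intermediate value treats finite and infinite \<open>q\<close> alike.\<close>
  obtain m where m: "p < m" "m < q" using dense[OF pq] by blast
  have "(\<lambda>k. p + ennreal (e k)) \<longlonglongrightarrow> p + ennreal 0"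
    using e_lim by (intro tendsto_add tendsto_const tendsto_ennrealI)
  then have "\<forall>\<^sub>F k in sequentially. p + ennreal (e k) < m"
    using m by (intro order_tendstoD(2)) auto
  moreover have "\<forall>\<^sub>F k in sequentially. m < N k"
    using \<open>N \<longlonglongrightarrow> q\<close> m(2) by (rule order_tendstoD(1))
  ultimately have "\<forall>\<^sub>F k in sequentially. p + ennreal (e k) < N k"
    by eventually_elim (rule less_trans)
  then obtain k where k: "p + ennreal (e k) < N k"
    unfolding eventually_sequentially by blast
  have "(\<integral>\<^sup>+ \<omega>. ennreal (ln (g \<omega> + e k)) \<partial>P) \<le> (\<integral>\<^sup>+ \<omega>. e2ennreal (eln (g \<omega>)) + ennreal (e k) \<partial>P)"
  proof (rule nn_integral_mono)
    fix \<omega>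
    have "ennreal (ln (g \<omega> + e k)) \<le> ennreal ((if g \<omega> = 0 then 0 else max 0 (ln (g \<omega>))) + e k)"
      by (intro ennreal_leI ln_add_le_pos_part g0 e)
    also have "\<dots> = e2ennreal (eln (g \<omega>)) + ennreal (e k)"
      unfolding e2ennreal_eln using e[of k] by (intro ennreal_plus) auto
    finally show "ennreal (ln (g \<omega> + e k)) \<le> e2ennreal (eln (g \<omega>)) + ennreal (e k)" .
  qed
  also have "\<dots> = p + ennreal (e k)"
    unfolding e2ennreal_eln p_def by (subst nn_integral_add) (auto simp: emeasure_space_1)
  finally have pos: "(\<integral>\<^sup>+ \<omega>. ennreal (ln (g \<omega> + e k)) \<partial>P) < N k"
    using k by (rule le_less_trans)
  \<comment> \<open>The shifted logarithm is at least \<open>ln (e k)\<close>, so its negative part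
    is bounded even where \<open>g\<close> vanishes.\<close>
  have "N k \<le> (\<integral>\<^sup>+ \<omega>. ennreal (- ln (e k)) \<partial>P)"
    unfolding N_def
  proof (intro nn_integral_mono ennreal_leI)
    fix \<omega>
    show "- ln (g \<omega> + e k) \<le> - ln (e k)"
      using g0[of \<omega>] e[of k] by simp
  qed
  also have "\<dots> < top" by (simp add: emeasure_space_1 less_top[symmetric])
  finally have Nfin: "N k < top" .
  have "integrable P (\<lambda>\<omega>. ln (g \<omega> + e k))"
    unfolding real_integrable_def using pos Nfin by (auto simp: N_def)
  moreover have "(\<integral>\<omega>. ln (g \<omega> + e k) \<partial>P) < 0"
    using calculation pos Nfin
    by (subst real_lebesgue_integral_def) (auto simp: N_def[symmetric] enn2real_less_iff enn2real_positive_iff)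
  ultimately show ?thesis using e by blast
qed

lemma contraction_from_derivative:
  fixes f :: "'b::{banach, second_countable_topology} \<Rightarrow> 'w \<Rightarrow> 'b"
  assumes P: "prob_space P"
    and f: "(\<lambda>(x, \<omega>). f x \<omega>) \<in> borel \<Otimes>\<^sub>M P \<rightarrow>\<^sub>M borel" and x0: "x0 \<in> P \<rightarrow>\<^sub>M borel"
    and lip: "lipschitz_at_equilibrium P f x0 XX L \<delta>"
    and F: "\<And>\<omega>. \<omega> \<in> space P \<Longrightarrow> ((\<lambda>x. f x \<omega>) has_derivative F \<omega>) (at (x0 \<omega>))"
    and neg: "ereal_expectation P (\<lambda>\<omega>. eln (onorm (F \<omega>))) < 0"
  shows "\<exists>L' \<delta>'. lipschitz_at_equilibrium P f x0 XX L' \<delta>' \<and> (\<integral>\<omega>. ln (L' \<omega>) \<partial>P) < 0"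
proof -
  interpret prob_space P by (rule P)
  note [measurable] = x0
  have L: "log_integrable P L" and \<delta>: "log_integrable P \<delta>"
    and lipschitz: "\<And>\<omega> x. \<omega> \<in> space P \<Longrightarrow> x \<in> local_ball XX x0 \<omega> (\<delta> \<omega>) \<Longrightarrow>
        dist (f x \<omega>) (f (x0 \<omega>) \<omega>) \<le> L \<omega> * dist x (x0 \<omega>)"
    using lip unfolding lipschitz_at_equilibrium_def by blast+
  have Lpos: "\<And>\<omega>. \<omega> \<in> space P \<Longrightarrow> L \<omega> > 0" and Lm [measurable]: "L \<in> borel_measurable P"
    and Li: "integrable P (\<lambda>\<omega>. ln (L \<omega>))"
    and \<delta>pos: "\<And>\<omega>. \<omega> \<in> space P \<Longrightarrow> \<delta> \<omega> > 0" and \<delta>m [measurable]: "\<delta> \<in> borel_measurable P"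
    and \<delta>i: "integrable P (\<lambda>\<omega>. ln (\<delta> \<omega>))"
    using L \<delta> by (auto simp: log_integrable_def pos_random_variable_def)
  \<comment> \<open>\<open>F\<close> is unconstrained outside \<open>space P\<close>; the value 0
    there makes \<open>g\<close> nonnegative everywhere, as \<open>expectation_ln_add_neg\<close>
    demands.\<close>
  define g where "g \<omega> = (if \<omega> \<in> space P then onorm (F \<omega>) else 0)" for \<omega>
  have bl: "bounded_linear (F \<omega>)" if "\<omega> \<in> space P" for \<omega>
    using F[OF that] by (rule has_derivative_bounded_linear)
  have g0: "0 \<le> g \<omega>" for \<omega>
    using onorm_pos_le[OF bl] by (simp add: g_def)
  have [measurable]: "g \<in> borel_measurable P"
    using borel_measurable_onorm_derivative[OF f x0 F]
    by (subst measurable_cong[where g = "\<lambda>\<omega>. onorm (F \<omega>)"]) (auto simp: g_def)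
  have "ereal_expectation P (\<lambda>\<omega>. eln (g \<omega>)) < 0"
  proof -
    have "(\<integral>\<^sup>+ \<omega>. e2ennreal (eln (g \<omega>)) \<partial>P) = (\<integral>\<^sup>+ \<omega>. e2ennreal (eln (onorm (F \<omega>))) \<partial>P)"
      "(\<integral>\<^sup>+ \<omega>. e2ennreal (- eln (g \<omega>)) \<partial>P) = (\<integral>\<^sup>+ \<omega>. e2ennreal (- eln (onorm (F \<omega>))) \<partial>P)"
      by (intro nn_integral_cong; simp add: g_def)+
    then show ?thesis using neg by (simp add: ereal_expectation_def)
  qed
  from expectation_ln_add_neg[OF P _ g0 this] obtain e where e: "e > 0"
    and li: "integrable P (\<lambda>\<omega>. ln (g \<omega> + e))" and lneg: "(\<integral>\<omega>. ln (g \<omega> + e) \<partial>P) < 0"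
    by auto
  define l where "l \<omega> = g \<omega> + e" for \<omega>
  have [measurable]: "l \<in> borel_measurable P" unfolding l_def by measurable
  have lpos: "l \<omega> > 0" for \<omega> using g0[of \<omega>] e by (simp add: l_def)
  define r where "r n = 1 / real (Suc n)" for n
  \<comment> \<open>The pairs at which the constant \<open>l\<close> fails within radius
    \<open>r n\<close>. The projection to the second coordinate is the exceptional set of \<omega>
    at this scale.\<close>
  define B where "B n = {p \<in> space (borel \<Otimes>\<^sub>M P). dist (fst p) (x0 (snd p)) \<le> r n \<and>
      l (snd p) * dist (fst p) (x0 (snd p)) < dist (f (fst p) (snd p)) (f (x0 (snd p)) (snd p))}" for n
  have [measurable]: "(\<lambda>p. f (fst p) (snd p)) \<in> borel \<Otimes>\<^sub>M P \<rightarrow>\<^sub>M borel"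
    using f by (simp add: case_prod_beta')
  have [measurable]: "(\<lambda>p. f (x0 (snd p)) (snd p)) \<in> (borel :: 'b measure) \<Otimes>\<^sub>M P \<rightarrow>\<^sub>M borel"
  proof -
    have "(\<lambda>p. (x0 (snd p), snd p)) \<in> (borel :: 'b measure) \<Otimes>\<^sub>M P \<rightarrow>\<^sub>M borel \<Otimes>\<^sub>M P" by measurable
    from measurable_compose[OF this f] show ?thesis by simp
  qed
  have Bm: "B n \<in> sets (borel \<Otimes>\<^sub>M P)" for n
    unfolding B_def by measurable
  have r_dec: "r n \<le> r m" if "m \<le> n" for m n
    using that by (simp add: r_def field_simps)
  have Bdec: "B n \<subseteq> B m" if "m \<le> n" for m n
    using r_dec[OF that] by (auto simp: B_def)
  have Bescape: "\<exists>n. \<omega> \<notin> snd ` B n" if \<omega>: "\<omega> \<in> space P" for \<omega>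
  proof -
    obtain d where d: "d > 0" "\<And>y. norm (y - x0 \<omega>) < d \<Longrightarrow>
        norm (f y \<omega> - f (x0 \<omega>) \<omega> - F \<omega> (y - x0 \<omega>)) \<le> e * norm (y - x0 \<omega>)"
      using F[OF \<omega>] e unfolding has_derivative_at_alt by blast
    obtain n where n: "r n < d"
      unfolding r_def using d(1) nat_approx_posE by blast
    have "dist (f y \<omega>) (f (x0 \<omega>) \<omega>) \<le> l \<omega> * dist y (x0 \<omega>)" if "dist y (x0 \<omega>) \<le> r n" for y
    proof -
      have "norm (f y \<omega> - f (x0 \<omega>) \<omega>) \<le>
          norm (f y \<omega> - f (x0 \<omega>) \<omega> - F \<omega> (y - x0 \<omega>)) + norm (F \<omega> (y - x0 \<omega>))"
        by (metis diff_add_cancel norm_triangle_ineq)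
      also have "\<dots> \<le> e * norm (y - x0 \<omega>) + onorm (F \<omega>) * norm (y - x0 \<omega>)"
        using that n by (intro add_mono d(2) onorm[OF bl[OF \<omega>]]) (simp add: dist_norm)
      also have "\<dots> = l \<omega> * norm (y - x0 \<omega>)"
        using \<omega> by (simp add: l_def g_def algebra_simps)
      finally show ?thesis by (simp add: dist_norm)
    qed
    then have "\<omega> \<notin> snd ` B n" by (force simp: B_def)
    then show ?thesis by blast
  qed
  have "\<forall>n. \<exists>EK. fst EK \<in> sets P \<and> snd EK \<in> sets P \<and> snd EK \<subseteq> snd ` B n \<and> snd ` B n \<subseteq> fst EK \<and>
      fst EK - snd EK \<in> null_sets P"
    using measurable_projection[OF finite_measure_axioms Bm] by (metis fst_conv snd_conv)
  from choice[OF this] obtain EK where EK: "\<And>n. fst (EK n) \<in> sets P"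
    "\<And>n. snd (EK n) \<subseteq> snd ` B n" "\<And>n. snd ` B n \<subseteq> fst (EK n)" "\<And>n. fst (EK n) - snd (EK n) \<in> null_sets P"
    by blast
  \<comment> \<open>The projections decrease with \<open>n\<close>, but their hulls were chosen
    separately. Intersecting them restores monotonicity, so that one escape from a hull is an escape
    from all later \<open>G m\<close>.\<close>
  define G where "G n = (\<Inter>m\<le>n. fst (EK m))" for n
  have [measurable]: "G n \<in> sets P" for n
    unfolding G_def using EK(1) by (intro sets.finite_INT) auto
  have Gescape: "AE \<omega> in P. \<exists>n. \<forall>m\<ge>n. \<omega> \<notin> G m"
  proof -
    have "AE \<omega> in P. \<forall>n. \<omega> \<notin> fst (EK n) - snd (EK n)"
      unfolding AE_all_countable using EK(4) AE_not_in by blast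
    with AE_space show ?thesis
    proof eventually_elim
      case (elim \<omega>)
      obtain n where "\<omega> \<notin> snd ` B n" using Bescape[OF elim(1)] by blast
      then have "\<omega> \<notin> fst (EK n)" using elim(2) EK(2) by blast
      then have "\<forall>m\<ge>n. \<omega> \<notin> G m" by (auto simp: G_def)
      then show ?case by blast
    qed
  qed
  define L' where "L' n \<omega> = (if \<omega> \<in> G n then L \<omega> else l \<omega>)" for n \<omega>
  define \<delta>' where "\<delta>' n \<omega> = (if \<omega> \<in> G n then \<delta> \<omega> else r n)" for n \<omega>
  have [measurable]: "L' n \<in> borel_measurable P" "\<delta>' n \<in> borel_measurable P" for n
    unfolding L'_def \<delta>'_def by measurable
  have bound: "integrable P (\<lambda>\<omega>. \<bar>ln (L \<omega>)\<bar> + \<bar>ln (l \<omega>)\<bar>)"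
    using Li li by (simp add: l_def)
  have L'i: "integrable P (\<lambda>\<omega>. ln (L' n \<omega>))" for n
    by (rule Bochner_Integration.integrable_bound[OF bound]) (auto simp: L'_def)
  have \<delta>'i: "integrable P (\<lambda>\<omega>. ln (\<delta>' n \<omega>))" for n
  proof (rule Bochner_Integration.integrable_bound)
    show "integrable P (\<lambda>\<omega>. \<bar>ln (\<delta> \<omega>)\<bar> + \<bar>ln (r n)\<bar>)" using \<delta>i by simp
  qed (auto simp: \<delta>'_def)
  \<comment> \<open>Almost every \<omega> eventually leaves \<open>G n\<close>, after which
    \<open>L' n\<close> equals \<open>l\<close>. Integrability of both \<open>ln L\<close> and
    \<open>ln l\<close> provides the dominating function.\<close>
  have "(\<lambda>n. \<integral>\<omega>. ln (L' n \<omega>) \<partial>P) \<longlonglongrightarrow> (\<integral>\<omega>. ln (l \<omega>) \<partial>P)"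
  proof (rule integral_dominated_convergence[OF _ _ bound])
    show "AE \<omega> in P. (\<lambda>n. ln (L' n \<omega>)) \<longlonglongrightarrow> ln (l \<omega>)"
      using Gescape
    proof eventually_elim
      case (elim \<omega>)
      then have "\<forall>\<^sub>F n in sequentially. ln (L' n \<omega>) = ln (l \<omega>)"
        unfolding eventually_sequentially L'_def by fastforce
      then show ?case by (rule tendsto_eventually)
    qed
    show "AE \<omega> in P. norm (ln (L' n \<omega>)) \<le> \<bar>ln (L \<omega>)\<bar> + \<bar>ln (l \<omega>)\<bar>" for n
      by (auto simp: L'_def)
  qed measurable
  then have "\<forall>\<^sub>F n in sequentially. (\<integral>\<omega>. ln (L' n \<omega>) \<partial>P) < 0"
    using lneg by (intro order_tendstoD(2)) (auto simp: l_def)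
  then obtain n where n: "(\<integral>\<omega>. ln (L' n \<omega>) \<partial>P) < 0"
    unfolding eventually_sequentially by blast
  have "lipschitz_at_equilibrium P f x0 XX (L' n) (\<delta>' n)"
    unfolding lipschitz_at_equilibrium_def log_integrable_def pos_random_variable_def
  proof (intro conjI ballI L'i \<delta>'i)
    fix \<omega> assume \<omega>: "\<omega> \<in> space P"
    show "0 < L' n \<omega>" using Lpos[OF \<omega>] lpos by (simp add: L'_def)
    show "0 < \<delta>' n \<omega>" using \<delta>pos[OF \<omega>] by (simp add: \<delta>'_def r_def)
  next
    fix \<omega> x assume \<omega>: "\<omega> \<in> space P" and x: "x \<in> local_ball XX x0 \<omega> (\<delta>' n \<omega>)"
    show "dist (f x \<omega>) (f (x0 \<omega>) \<omega>) \<le> L' n \<omega> * dist x (x0 \<omega>)"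
    proof (cases "\<omega> \<in> G n")
      case True
      then show ?thesis using lipschitz[OF \<omega>, of x] x by (simp add: L'_def \<delta>'_def)
    next
      case False
      \<comment> \<open>Outside a hull the point lies outside the projection with no exception, so
        the Lipschitz bound holds for every \<omega>, as \<open>lipschitz_at_equilibrium\<close>
        demands.\<close>
      then obtain m where "m \<le> n" "\<omega> \<notin> fst (EK m)" by (auto simp: G_def)
      then have "\<omega> \<notin> snd ` B n" using EK(3) Bdec by blast
      then have "(x, \<omega>) \<notin> B n" by force
      then show ?thesis
        using x \<omega> False by (auto simp: B_def L'_def \<delta>'_def local_ball_def space_pair_measure)
    qed
  qed measurable
  then show ?thesis using n by blast
qed

text \<open>The alternative between (A) and (B) appears as a conjunction over two state space types,
  since the two conditions presuppose different type classes.\<close>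

theorem theorem2:
  fixes P :: "'w measure" and TT :: "real set" and T :: "real \<Rightarrow> 'w \<Rightarrow> 'w"
  shows
    "(\<forall>(C :: real \<Rightarrow> 'x::polish_space \<Rightarrow> 'w \<Rightarrow> 'x) xbar XX.
        cocycle_with_equilibrium P TT T C xbar XX \<and>
        (\<exists>M\<in>TT. M > 0 \<and> contraction_A P (C M) (xbar 0) XX \<and>
           hoelder_up_to P TT C (xbar 0) XX M)
        \<longrightarrow> locally_exponentially_stable P TT C xbar XX)
     \<and>
     (\<forall>(C :: real \<Rightarrow> 'b::{banach, second_countable_topology} \<Rightarrow> 'w \<Rightarrow> 'b) xbar XX.
        cocycle_with_equilibrium P TT T C xbar XX \<and>
        (\<exists>M\<in>TT. M > 0 \<and> contraction_B P (C M) (xbar 0) XX \<and>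
           hoelder_up_to P TT C (xbar 0) XX M)
        \<longrightarrow> locally_exponentially_stable P TT C xbar XX)"
proof (intro conjI allI impI; elim conjE bexE)
  fix C :: "real \<Rightarrow> 'x \<Rightarrow> 'w \<Rightarrow> 'x" and xbar XX M
  assume coc: "cocycle_with_equilibrium P TT T C xbar XX" and M: "M \<in> TT" "M > 0"
    and con: "contraction_A P (C M) (xbar 0) XX" and hoe: "hoelder_up_to P TT C (xbar 0) XX M"
  from con obtain L \<delta> where "lipschitz_at_equilibrium P (C M) (xbar 0) XX L \<delta>"
    "(\<integral>\<omega>. ln (L \<omega>) \<partial>P) < 0"
    unfolding contraction_A_def by blast
  with coc M hoe show "locally_exponentially_stable P TT C xbar XX"
    by (intro cocycle_with_equilibrium.stable_if_contracting)
next
  fix C :: "real \<Rightarrow> 'b \<Rightarrow> 'w \<Rightarrow> 'b" and xbar XX M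
  assume coc: "cocycle_with_equilibrium P TT T C xbar XX" and M: "M \<in> TT" "M > 0"
    and con: "contraction_B P (C M) (xbar 0) XX" and hoe: "hoelder_up_to P TT C (xbar 0) XX M"
  interpret cocycle_with_equilibrium P TT T C xbar XX by (rule coc)
  obtain L \<delta> F where lip: "lipschitz_at_equilibrium P (C M) (xbar 0) XX L \<delta>"
    and F: "\<And>\<omega>. \<omega> \<in> space P \<Longrightarrow> ((\<lambda>x. C M x \<omega>) has_derivative F \<omega>) (at (xbar 0 \<omega>))"
    and neg: "ereal_expectation P (\<lambda>\<omega>. eln (onorm (F \<omega>))) < 0"
    using con unfolding contraction_B_def by blast
  obtain L' \<delta>' where "lipschitz_at_equilibrium P (C M) (xbar 0) XX L' \<delta>'"
    "(\<integral>\<omega>. ln (L' \<omega>) \<partial>P) < 0"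
    using contraction_from_derivative[OF prob_space_axioms C_measurable[OF M(1)]
        xbar_measurable[OF time_0] lip F neg] by blast
  then show "locally_exponentially_stable P TT C xbar XX"
    using M hoe by (intro stable_if_contracting)
qed

end
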